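(* Let $M$ be a metric space that is of coarse bounded geometry, coarsely quasi-convex and coarsely quasi-symmetric. Then, either the space $\mathcal E_\infty(M)$ of coarse ends of $M$ satisfies $|\mathcal E_\infty(M)|\le2$, or $\mathcal E_\infty(M)$ is a Cantor space.
   Context: Let $M$ be a metric space with metric $d$. Coarse bounded geometry: there are a subset $\Gamma\subset M$, some $R\ge0$ and a function $r\mapsto Q_r$ ($r,Q_r\ge0$) such that every point of $M$ is at distance $\le R$ from some point of $\Gamma$ and every closed ball of radius $r$ in $M$ contains at most $Q_r$ points of $\Gamma$, for all $r\ge0$. Coarsely quasi-convex: there are $a,b,c\ge0$ such that for all $x,y\in M$ there is a finite sequence $x=x_0,\dots,x_n=y$ in $M$ with $d(x_{k-1},x_k)\le c$ for all $k$ and $\sum_{k=1}^nd(x_{k-1},x_k)\le a\,d(x,y)+b$. Coarsely quasi-symmetric: there are $K\ge0$, $C\ge1$ such that for all $x,y\in M$ there are subsets $A,A'\subset M$, with $x\in A$ and $y\in A'$, each of which is a $K$-net in $M$ (every point of $M$ is at distance $\le K$ from some point of the subset), and a bijection $f:A\to A'$ with $f(x)=y$ and $\frac1Cd(u,v)\le d(f(u),f(v))\le C\,d(u,v)$ for all $u,v\in A$. Coarse ends. For $\mu>0$, two points of a subset $S\subset M$ are coarsely $\mu$-connected in $S$ if they can be joined by a finite sequence of points of $S$ with consecutive distances $\le\mu$; the equivalence classes are the coarse $\mu$-connected components of $S$. For a bounded subset $B\subset M$, let $\mathcal U_{\mu,B}$ be the discrete space of unbounded coarse $\mu$-connected components of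 $M\setminus B$. For bounded sets $B\subset C$, there is a map $\mathcal U_{\mu,C}\to\mathcal U_{\mu,B}$ sending $U$ to the component containing $U$. Let $\mathcal E_\mu(M)$ be the inverse limit of the spaces $\mathcal U_{\mu,B}$ over the bounded subsets $B$ directed by inclusion. For $0<\mu\le\nu$, the maps $\mathcal U_{\mu,B}\to\mathcal U_{\nu,B}$ sending $U$ to the coarse $\nu$-connected component containing $U$ induce continuous maps $\theta_{\mu,\nu}:\mathcal E_\mu(M)\to\mathcal E_\nu(M)$. The space of coarse ends $\mathcal E_\infty(M)$ is the direct limit (as topological spaces) of $\{\mathcal E_\mu(M),\theta_{\mu,\nu}\}$ over $\mu>0$. A Cantor space is a space homeomorphic to the Cantor set. *)

theory Defs
  imports "HOL-Analysis.Analysis"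
begin

section \<open>Coarse conditions on a metric space\<close>

text \<open>The metric space is the whole type \<^typ>\<open>'a\<close> of class \<^class>\<open>metric_space\<close>. The conditions are
  properties of the type, so the constants take an argument of type \<^typ>\<open>'a itself\<close>.\<close>

definition coarse_bounded_geometry :: "'a::metric_space itself \<Rightarrow> bool" where
  "coarse_bounded_geometry _ \<longleftrightarrow>
    (\<exists>(\<Gamma> :: 'a set) (R :: real) (Q :: real \<Rightarrow> real).
       R \<ge> 0 \<and> (\<forall>r\<ge>0. Q r \<ge> 0) \<and>
       (\<forall>x. \<exists>y\<in>\<Gamma>. dist x y \<le> R) \<and>
       (\<forall>x. \<forall>r\<ge>0. finite (cball x r \<inter> \<Gamma>) \<and> real (card (cball x r \<inter> \<Gamma>)) \<le> Q r))"

definition coarsely_quasi_convex :: "'a::metric_space itself \<Rightarrow> bool" where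
  "coarsely_quasi_convex _ \<longleftrightarrow>
    (\<exists>a b c :: real. a \<ge> 0 \<and> b \<ge> 0 \<and> c \<ge> 0 \<and>
       (\<forall>x y :: 'a. \<exists>(n :: nat) (p :: nat \<Rightarrow> 'a).
          p 0 = x \<and> p n = y \<and>
          (\<forall>k\<in>{1..n}. dist (p (k - 1)) (p k) \<le> c) \<and>
          (\<Sum>k=1..n. dist (p (k - 1)) (p k)) \<le> a * dist x y + b))"

definition metric_net :: "real \<Rightarrow> 'a::metric_space set \<Rightarrow> bool" where
  "metric_net K A \<longleftrightarrow> (\<forall>z. \<exists>u\<in>A. dist z u \<le> K)"

definition coarsely_quasi_symmetric :: "'a::metric_space itself \<Rightarrow> bool" where
  "coarsely_quasi_symmetric _ \<longleftrightarrow>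
    (\<exists>K C :: real. K \<ge> 0 \<and> C \<ge> 1 \<and>
       (\<forall>x y :: 'a. \<exists>(A :: 'a set) (A' :: 'a set) (f :: 'a \<Rightarrow> 'a).
          x \<in> A \<and> y \<in> A' \<and> metric_net K A \<and> metric_net K A' \<and>
          bij_betw f A A' \<and> f x = y \<and>
          (\<forall>u\<in>A. \<forall>v\<in>A. 1 / C * dist u v \<le> dist (f u) (f v) \<and>
                          dist (f u) (f v) \<le> C * dist u v)))"


section \<open>Coarse components\<close>

definition coarse_rel :: "real \<Rightarrow> 'a::metric_space set \<Rightarrow> ('a \<times> 'a) set" where
  "coarse_rel \<mu> S = {(x, y). \<exists>(n :: nat) (p :: nat \<Rightarrow> 'a).
     p 0 = x \<and> p n = y \<and> (\<forall>k\<le>n. p k \<in> S) \<and> (\<forall>k\<in>{1..n}. dist (p (k - 1)) (p k) \<le> \<mu>)}"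

definition coarse_components :: "real \<Rightarrow> 'a::metric_space set \<Rightarrow> 'a set set" where
  "coarse_components \<mu> S = S // coarse_rel \<mu> S"

definition unbounded_components :: "real \<Rightarrow> 'a::metric_space set \<Rightarrow> 'a set set" where
  "unbounded_components \<mu> B = {U \<in> coarse_components \<mu> (- B). \<not> bounded U}"

text \<open>\<open>component_map \<mu> B U\<close> is the component containing \<open>U\<close>. It serves for both families
  of maps: \<open>\<U>\<^bsub>\<mu>,C\<^esub> \<rightarrow> \<U>\<^bsub>\<mu>,B\<^esub>\<close> for \<open>B \<subseteq> C\<close>, and \<open>\<U>\<^bsub>\<mu>,B\<^esub> \<rightarrow> \<U>\<^bsub>\<nu>,B\<^esub>\<close> for \<open>\<mu> \<le> \<nu>\<close>;
  see \<open>component_map_unique\<close> below.\<close>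

definition component_map :: "real \<Rightarrow> 'a::metric_space set \<Rightarrow> 'a set \<Rightarrow> 'a set" where
  "component_map \<mu> B U = (THE V. V \<in> unbounded_components \<mu> B \<and> U \<subseteq> V)"

lemma coarse_relI:
  fixes p :: "nat \<Rightarrow> 'a::metric_space"
  shows "p 0 = x \<Longrightarrow> p n = y \<Longrightarrow> (\<And>k. k \<le> n \<Longrightarrow> p k \<in> S) \<Longrightarrow>
   (\<And>k. k \<in> {1..n} \<Longrightarrow> dist (p (k - 1)) (p k) \<le> \<mu>) \<Longrightarrow> (x, y) \<in> coarse_rel \<mu> S"
  unfolding coarse_rel_def mem_Collect_eq prod.case by (intro exI[of _ n] exI[of _ p] conjI ballI allI impI)

lemma coarse_relE:
  assumes "(x, y) \<in> coarse_rel \<mu> S"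
  obtains n and p :: "nat \<Rightarrow> 'a::metric_space" where "p 0 = x" "p n = y" "\<And>k. k \<le> n \<Longrightarrow> p k \<in> S"
    "\<And>k. k \<in> {1..n} \<Longrightarrow> dist (p (k - 1)) (p k) \<le> \<mu>"
  using assms unfolding coarse_rel_def mem_Collect_eq prod.case by blast

lemma equiv_coarse_rel: "equiv S (coarse_rel \<mu> S)"
proof (rule equivI)
  show "coarse_rel \<mu> S \<subseteq> S \<times> S"
    by (fastforce elim!: coarse_relE)
  show "refl_on S (coarse_rel \<mu> S)"
  proof (rule refl_onI)
    fix x assume "x \<in> S"
    then show "(x, x) \<in> coarse_rel \<mu> S"
      by (intro coarse_relI[of "\<lambda>_. x" x 0]) auto
  qed
  show "sym (coarse_rel \<mu> S)"
  proof (rule symI)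
    fix x y assume "(x, y) \<in> coarse_rel \<mu> S"
    then obtain n :: nat and p where p: "p 0 = x" "p n = y" "\<And>k. k \<le> n \<Longrightarrow> p k \<in> S"
      "\<And>k. k \<in> {1..n} \<Longrightarrow> dist (p (k - 1)) (p k) \<le> \<mu>"
      by (rule coarse_relE) blast
    show "(y, x) \<in> coarse_rel \<mu> S"
    proof (rule coarse_relI[of "\<lambda>k. p (n - k)" y n])
      fix k assume k: "k \<in> {1..n}"
      then have "dist (p (Suc (n - k) - 1)) (p (Suc (n - k))) \<le> \<mu>"
        by (intro p(4)) auto
      moreover have "Suc (n - k) = n - (k - 1)"
        using k by auto
      ultimately show "dist (p (n - (k - 1))) (p (n - k)) \<le> \<mu>"
        by (simp add: dist_commute)
    qed (use p in auto)
  qed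
  show "trans (coarse_rel \<mu> S)"
  proof (rule transI)
    fix x y z assume "(x, y) \<in> coarse_rel \<mu> S" "(y, z) \<in> coarse_rel \<mu> S"
    then obtain n m :: nat and p q where p: "p 0 = x" "p n = y" "\<And>k. k \<le> n \<Longrightarrow> p k \<in> S"
      "\<And>k. k \<in> {1..n} \<Longrightarrow> dist (p (k - 1)) (p k) \<le> \<mu>"
      and q: "q 0 = y" "q m = z" "\<And>k. k \<le> m \<Longrightarrow> q k \<in> S"
      "\<And>k. k \<in> {1..m} \<Longrightarrow> dist (q (k - 1)) (q k) \<le> \<mu>"
      by (elim coarse_relE) blast
    show "(x, z) \<in> coarse_rel \<mu> S"
    proof (rule coarse_relI[of "\<lambda>k. if k \<le> n then p k else q (k - n)" x "n + m"])
      fix k assume k: "k \<in> {1..n + m}"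
      consider "k \<le> n" | "k = Suc n" | "k > Suc n" by linarith
      then show "dist (if k - 1 \<le> n then p (k - 1) else q (k - 1 - n))
                  (if k \<le> n then p k else q (k - n)) \<le> \<mu>"
      proof cases
        case 1 then show ?thesis using p(4)[of k] k by auto
      next
        case 2 then show ?thesis using q(4)[of 1] q(1) p(2) k by auto
      next
        case 3
        have "k - n - 1 = k - 1 - n" "k - n \<in> {1..m}" using 3 k by auto
        then show ?thesis using q(4)[of "k - n"] 3 by auto
      qed
    next
      fix k assume "k \<le> n + m"
      then show "(if k \<le> n then p k else q (k - n)) \<in> S"
        using p(3) q(3) by auto
    qed (use p q in auto)
  qed
qed

lemma coarse_rel_mono:
  "\<mu> \<le> \<nu> \<Longrightarrow> S \<subseteq> T \<Longrightarrow> coarse_rel \<mu> S \<subseteq> coarse_rel \<nu> T"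
proof (rule subrelI)
  fix x y assume *: "\<mu> \<le> \<nu>" "S \<subseteq> T" "(x, y) \<in> coarse_rel \<mu> S"
  from *(3) obtain n :: nat and p where p: "p 0 = x" "p n = y" "\<And>k. k \<le> n \<Longrightarrow> p k \<in> S"
    "\<And>k. k \<in> {1..n} \<Longrightarrow> dist (p (k - 1)) (p k) \<le> \<mu>"
    by (rule coarse_relE) blast
  show "(x, y) \<in> coarse_rel \<nu> T"
    by (rule coarse_relI[OF p(1,2)]) (use p(3) * order_trans[OF p(4) *(1)] in auto)
qed

lemma component_map_unique:
  assumes U: "U \<in> unbounded_components \<mu> C" and "\<mu> \<le> \<nu>" "B \<subseteq> C"
  shows "\<exists>!V. V \<in> unbounded_components \<nu> B \<and> U \<subseteq> V"
proof -
  obtain x where x: "x \<in> - C" "U = coarse_rel \<mu> (- C) `` {x}" and unb: "\<not> bounded U"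
    using U unfolding unbounded_components_def coarse_components_def by (auto elim!: quotientE)
  define V where "V = coarse_rel \<nu> (- B) `` {x}"
  have UV: "U \<subseteq> V"
    using coarse_rel_mono[of \<mu> \<nu> "- C" "- B"] assms x unfolding V_def by auto
  have V: "V \<in> (- B) // coarse_rel \<nu> (- B)"
    unfolding V_def using x assms by (intro quotientI) auto
  then have "V \<in> unbounded_components \<nu> B"
    using UV unb bounded_subset unfolding unbounded_components_def coarse_components_def by blast
  moreover have "W = V" if W: "W \<in> unbounded_components \<nu> B" "U \<subseteq> W" for W
  proof -
    have "W \<inter> V \<noteq> {}"
      using W UV unb by (metis bounded_empty bounded_subset le_infI)
    then show ?thesis
      using quotient_disj[OF equiv_coarse_rel[of "- B" \<nu>], of W V] W V
      unfolding unbounded_components_def coarse_components_def by blast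
  qed
  ultimately show ?thesis using UV by blast
qed

lemma component_map:
  assumes "U \<in> unbounded_components \<mu> C" "\<mu> \<le> \<nu>" "B \<subseteq> C"
  shows "component_map \<nu> B U \<in> unbounded_components \<nu> B" "U \<subseteq> component_map \<nu> B U"
  using theI'[OF component_map_unique[OF assms]] unfolding component_map_def by auto

lemma component_map_eqI:
  assumes "U \<in> unbounded_components \<mu> C" "\<mu> \<le> \<nu>" "B \<subseteq> C"
    and "V \<in> unbounded_components \<nu> B" "U \<subseteq> V"
  shows "component_map \<nu> B U = V"
  using component_map[OF assms(1-3)] component_map_unique[OF assms(1-3)] assms(4,5) by blast


section \<open>The inverse limits\<close>

definition coarse_threads :: "real \<Rightarrow> ('a::metric_space set \<Rightarrow> 'a set) set" where
  "coarse_threads \<mu> = {e \<in> (\<Pi>\<^sub>E B\<in>{B. bounded B}. unbounded_components \<mu> B).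
     \<forall>B C. bounded C \<and> B \<subseteq> C \<longrightarrow> component_map \<mu> B (e C) = e B}"

definition coarse_ends_at :: "real \<Rightarrow> ('a::metric_space set \<Rightarrow> 'a set) topology" where
  "coarse_ends_at \<mu> =
     subtopology
       (product_topology (\<lambda>B. discrete_topology (unbounded_components \<mu> B)) {B. bounded B})
       (coarse_threads \<mu>)"

text \<open>The map \<open>\<theta>\<^bsub>\<mu>,\<nu>\<^esub>\<close>, for \<open>\<mu> \<le> \<nu>\<close>; its values depend on \<open>\<mu>\<close> only through the argument.\<close>

definition ends_map :: "real \<Rightarrow> ('a::metric_space set \<Rightarrow> 'a set) \<Rightarrow> ('a set \<Rightarrow> 'a set)" where
  "ends_map \<nu> e = (\<lambda>B\<in>{B. bounded B}. component_map \<nu> B (e B))"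

lemma topspace_coarse_ends_at [simp]: "topspace (coarse_ends_at \<mu>) = coarse_threads \<mu>"
  unfolding coarse_ends_at_def coarse_threads_def by auto

lemma coarse_threadsD:
  assumes "e \<in> coarse_threads \<mu>" "bounded B"
  shows "e B \<in> unbounded_components \<mu> B"
  using assms unfolding coarse_threads_def by auto

lemma ends_map_in:
  assumes e: "e \<in> coarse_threads \<mu>" and "\<mu> \<le> \<nu>"
  shows "ends_map \<nu> e \<in> coarse_threads \<nu>"
proof -
  have "component_map \<nu> B (component_map \<nu> C (e C)) = component_map \<nu> B (e B)"
    if "bounded C" "B \<subseteq> C" for B C
  proof -
    have B: "bounded B" using that bounded_subset by blast
    have eq: "component_map \<mu> B (e C) = e B"
      using e that unfolding coarse_threads_def by auto
    have "e C \<subseteq> e B"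
      using component_map(2)[OF coarse_threadsD[OF e that(1)] order_refl that(2)] eq by simp
    also note b = component_map[OF coarse_threadsD[OF e B] \<open>\<mu> \<le> \<nu>\<close> order_refl]
    note b(2)
    finally have sub: "e C \<subseteq> component_map \<nu> B (e B)" .
    note c = component_map[OF coarse_threadsD[OF e that(1)] \<open>\<mu> \<le> \<nu>\<close> order_refl]
    note d = component_map[OF c(1) order_refl that(2)]
    show ?thesis
      using component_map_unique[OF coarse_threadsD[OF e that(1)] \<open>\<mu> \<le> \<nu>\<close> that(2)]
        sub b(1) c(2) d by (metis order_trans)
  qed
  moreover have "component_map \<nu> B (e B) \<in> unbounded_components \<nu> B" if "bounded B" for B
    using component_map(1)[OF coarse_threadsD[OF e that] \<open>\<mu> \<le> \<nu>\<close> order_refl] .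
  ultimately show ?thesis
    unfolding coarse_threads_def ends_map_def by (auto dest: bounded_subset)
qed

lemma ends_map_comp:
  assumes e: "e \<in> coarse_threads \<mu>" and "\<mu> \<le> \<nu>" "\<nu> \<le> \<kappa>"
  shows "ends_map \<kappa> (ends_map \<nu> e) = ends_map \<kappa> e"
proof -
  have "component_map \<kappa> B (component_map \<nu> B (e B)) = component_map \<kappa> B (e B)"
    if "bounded B" for B
  proof -
    note c = component_map[OF coarse_threadsD[OF e that] \<open>\<mu> \<le> \<nu>\<close> order_refl]
    note d = component_map[OF c(1) \<open>\<nu> \<le> \<kappa>\<close> order_refl]
    show ?thesis
      using component_map_eqI[OF coarse_threadsD[OF e that] order_trans[OF assms(2,3)] order_refl d(1)]
        c(2) d(2) by auto
  qed
  then show ?thesis unfolding ends_map_def by (intro restrict_ext) simp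
qed


section \<open>The direct limit\<close>

definition quotient_topology :: "'b topology \<Rightarrow> ('b \<times> 'b) set \<Rightarrow> 'b set topology" where
  "quotient_topology X r =
     topology (\<lambda>W. W \<subseteq> topspace X // r \<and> openin X {x \<in> topspace X. r `` {x} \<in> W})"

lemma openin_quotient_topology:
  "openin (quotient_topology X r) W \<longleftrightarrow>
     W \<subseteq> topspace X // r \<and> openin X {x \<in> topspace X. r `` {x} \<in> W}"
proof -
  have "istopology (\<lambda>W. W \<subseteq> topspace X // r \<and> openin X {x \<in> topspace X. r `` {x} \<in> W})"
    unfolding istopology_def
  proof (intro conjI allI impI; (elim conjE)?)
    fix V W
    assume "openin X {x \<in> topspace X. r `` {x} \<in> V}" "openin X {x \<in> topspace X. r `` {x} \<in> W}"
    then have "openin X ({x \<in> topspace X. r `` {x} \<in> V} \<inter> {x \<in> topspace X. r `` {x} \<in> W})"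
      by blast
    then show "openin X {x \<in> topspace X. r `` {x} \<in> V \<inter> W}"
      by (rule back_subst[where P = "openin X"]) auto
  next
    fix \<K>
    assume "\<forall>W\<in>\<K>. W \<subseteq> topspace X // r \<and> openin X {x \<in> topspace X. r `` {x} \<in> W}"
    then have "openin X (\<Union>W\<in>\<K>. {x \<in> topspace X. r `` {x} \<in> W})"
      by blast
    then show "openin X {x \<in> topspace X. r `` {x} \<in> \<Union>\<K>}"
      by (rule back_subst[where P = "openin X"]) auto
  qed blast+
  then show ?thesis unfolding quotient_topology_def by simp
qed

lemma topspace_quotient_topology [simp]: "topspace (quotient_topology X r) = topspace X // r"
proof
  show "topspace (quotient_topology X r) \<subseteq> topspace X // r"
    using openin_quotient_topology openin_topspace by blast
  have "{x \<in> topspace X. r `` {x} \<in> topspace X // r} = topspace X"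
    by (auto intro: quotientI)
  then have "openin (quotient_topology X r) (topspace X // r)"
    unfolding openin_quotient_topology by simp
  then show "topspace X // r \<subseteq> topspace (quotient_topology X r)"
    by (rule openin_subset)
qed

lemma quotient_map_quotient_topology: "quotient_map X (quotient_topology X r) (\<lambda>x. r `` {x})"
  unfolding quotient_map_def by (auto simp: openin_quotient_topology quotient_def)

text \<open>Two threads represent the same coarse end iff they have the same image in some
  later \<open>\<E>\<^bsub>\<kappa>\<^esub>\<close>.\<close>

definition ends_rel :: "((real \<times> ('a::metric_space set \<Rightarrow> 'a set)) \<times>
    (real \<times> ('a set \<Rightarrow> 'a set))) set" where
  "ends_rel = {((\<mu>, e), (\<nu>, e')). \<mu> > 0 \<and> \<nu> > 0 \<and> e \<in> coarse_threads \<mu> \<and> e' \<in> coarse_threads \<nu> \<and>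
     (\<exists>\<kappa>. \<mu> \<le> \<kappa> \<and> \<nu> \<le> \<kappa> \<and> ends_map \<kappa> e = ends_map \<kappa> e')}"

definition coarse_ends :: "(real \<times> ('a::metric_space set \<Rightarrow> 'a set)) set topology" where
  "coarse_ends = quotient_topology (sum_topology coarse_ends_at {0<..}) ends_rel"

lemma equiv_ends_rel:
  "equiv (topspace (sum_topology coarse_ends_at {0<..})) (ends_rel :: (_ \<times> (_ \<times> ('a::metric_space set \<Rightarrow> _))) set)"
proof (rule equivI)
  show "trans (ends_rel :: (_ \<times> (_ \<times> ('a set \<Rightarrow> _))) set)"
  proof (rule transI, clarify)
    fix \<mu> \<nu> \<rho> and e f g :: "'a set \<Rightarrow> 'a set"
    assume "((\<mu>, e), (\<nu>, f)) \<in> ends_rel" "((\<nu>, f), (\<rho>, g)) \<in> ends_rel"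
    then obtain \<kappa> \<kappa>' where
      *: "\<mu> > 0" "\<nu> > 0" "\<rho> > 0" "e \<in> coarse_threads \<mu>" "f \<in> coarse_threads \<nu>" "g \<in> coarse_threads \<rho>"
         "\<mu> \<le> \<kappa>" "\<nu> \<le> \<kappa>" "\<nu> \<le> \<kappa>'" "\<rho> \<le> \<kappa>'"
      and eq: "ends_map \<kappa> e = ends_map \<kappa> f" "ends_map \<kappa>' f = ends_map \<kappa>' g"
      unfolding ends_rel_def by auto
    define m where "m = max \<kappa> \<kappa>'"
    have m: "\<kappa> \<le> m" "\<kappa>' \<le> m" by (auto simp: m_def)
    have "ends_map m e = ends_map m g"
      using ends_map_comp[OF *(4,7) m(1)] ends_map_comp[OF *(5,8) m(1)]
        ends_map_comp[OF *(5,9) m(2)] ends_map_comp[OF *(6,10) m(2)] eq by metis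
    then show "((\<mu>, e), (\<rho>, g)) \<in> ends_rel"
      unfolding ends_rel_def using * m by (auto intro!: exI[of _ m])
  qed
  show "sym (ends_rel :: (_ \<times> (_ \<times> ('a set \<Rightarrow> _))) set)"
    unfolding sym_def ends_rel_def by (auto; metis)
qed (auto simp: refl_on_def ends_rel_def)


section \<open>The Cantor set\<close>

primrec cantor_stage :: "nat \<Rightarrow> real set" where
  "cantor_stage 0 = {0..1}"
| "cantor_stage (Suc n) = (\<lambda>x. x / 3) ` cantor_stage n \<union> (\<lambda>x. (x + 2) / 3) ` cantor_stage n"

definition cantor_set :: "real set" where
  "cantor_set = (\<Inter>n. cantor_stage n)"

definition cantor_space :: "'b topology \<Rightarrow> bool" where
  "cantor_space X \<longleftrightarrow> X homeomorphic_space top_of_set cantor_set"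

end

theory Submission
  imports Defs
begin

text \<open>Quasi-convexity bounds the detour needed to replace a jump of length \<open>\<nu>\<close> by jumps of length
  \<open>\<mu>\<close>; so for large \<open>\<mu>\<close> the maps \<open>\<theta>\<^bsub>\<mu>,\<nu>\<^esub>\<close> are homeomorphisms and \<open>\<E>\<^bsub>\<infinity>\<^esub>\<close> is \<open>\<E>\<^bsub>\<mu>\<^esub>\<close>. Bounded geometry
  makes all \<open>\<U>\<^bsub>\<mu>,B\<^esub>\<close> finite, so \<open>\<E>\<^bsub>\<mu>\<^esub>\<close> is compact with a countable separating family of clopen sets.
  If there are three ends, some ball has three unbounded complementary components; by
  quasi-symmetry there are balls of one fixed radius with this property around every point. Placing such a
  ball far out towards a given end splits every neighbourhood of that end, so no end is isolated.\<close>

section \<open>Ternary expansions\<close>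

text \<open>Two losses shape the constants. Replacing a \<open>\<nu>\<close>-jump by
  \<open>\<mu>\<close>-jumps leads the chain up to \<open>a * \<nu> + b\<close> away from its start,
  so each comparison of scales costs a thickening of the bounded set to be avoided. A quasi-symmetry
  only relates two nets; its coarse inverse \<open>k\<close> lengthens \<open>\<mu>\<close>-jumps,
  which must then be shortened again at that price. What rescues the argument is that the resulting
  radius \<open>r'\<close> in \<open>transport_components\<close> is the same for all target points:
  the ball can be placed after its size is known, so far out that chains near it and chains near the
  set \<open>C\<close> to be avoided do not interfere. The inverse limit runs over all bounded sets.
  The balls \<open>cball x0 (real n)\<close> are cofinal among them, which lets threads be built by
  recursion and gives the countable separating family.\<close>

definition ternary :: "(nat \<Rightarrow> bool) \<Rightarrow> real" where
  "ternary b = (\<Sum>n. (if b n then 2 else 0) / 3 ^ Suc n)"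

lemma sums_two_thirds: "(\<lambda>n. 2 / 3 ^ Suc n) sums (1 :: real)"
proof -
  have "(\<lambda>n. 2 / 3 * (1 / 3) ^ n) sums (2 / 3 * (1 / (1 - 1 / 3 :: real)))"
    by (intro sums_mult geometric_sums) auto
  then show ?thesis by (simp add: power_one_over field_simps)
qed

lemma summable_ternary: "summable (\<lambda>n. (if b n then 2 else 0) / 3 ^ Suc n :: real)"
  by (rule summable_comparison_test'[OF sums_summable[OF sums_two_thirds], of 0]) auto

lemma ternary_nonneg: "0 \<le> ternary b"
  unfolding ternary_def by (intro suminf_nonneg summable_ternary) auto

lemma ternary_le_1: "ternary b \<le> 1"
proof -
  have "ternary b \<le> (\<Sum>n. 2 / 3 ^ Suc n)"
    unfolding ternary_def
    by (intro suminf_le summable_ternary sums_summable[OF sums_two_thirds]) (auto simp: divide_simps)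
  also have "\<dots> = 1" using sums_two_thirds by (rule sums_unique[symmetric])
  finally show ?thesis .
qed

lemma ternary_rec: "ternary b = ((if b 0 then 2 else 0) + ternary (\<lambda>n. b (Suc n))) / 3"
proof -
  have "ternary b = (\<Sum>n. (if b (Suc n) then 2 else 0) / 3 ^ Suc (Suc n)) + (if b 0 then 2 else 0) / 3"
    unfolding ternary_def
    using suminf_split_head[OF summable_ternary[of b]] by simp
  also have "(\<Sum>n. (if b (Suc n) then 2 else 0) / 3 ^ Suc (Suc n)) = ternary (\<lambda>n. b (Suc n)) / 3"
    unfolding ternary_def suminf_divide[OF summable_ternary, symmetric]
    by (intro suminf_cong) auto
  finally show ?thesis by (simp add: field_simps)
qed

lemma ternary_in_stage: "ternary b \<in> cantor_stage n"
proof (induction n arbitrary: b)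
  case 0
  then show ?case using ternary_nonneg ternary_le_1 by auto
next
  case (Suc n)
  show ?case
    using Suc.IH[of "\<lambda>n. b (Suc n)"] by (subst ternary_rec) (auto simp: add.commute)
qed

text \<open>With first digit 0 the value is at most 1/3, with first digit 2 at least 2/3. So the
  first digit can be read off, and \<open>ternary_rec\<close> removes it.\<close>

lemma ternary_eqD: "ternary b = ternary b' \<Longrightarrow> b n = b' n"
proof (induction n arbitrary: b b')
  case 0
  show ?case
    using 0 ternary_rec[of b] ternary_rec[of b'] ternary_nonneg[of "\<lambda>n. b (Suc n)"]
      ternary_nonneg[of "\<lambda>n. b' (Suc n)"] ternary_le_1[of "\<lambda>n. b (Suc n)"]
      ternary_le_1[of "\<lambda>n. b' (Suc n)"]
    by (auto split: if_splits)
next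
  case (Suc n)
  have "b 0 = b' 0"
    using Suc.prems ternary_rec[of b] ternary_rec[of b'] ternary_nonneg[of "\<lambda>n. b (Suc n)"]
      ternary_nonneg[of "\<lambda>n. b' (Suc n)"] ternary_le_1[of "\<lambda>n. b (Suc n)"]
      ternary_le_1[of "\<lambda>n. b' (Suc n)"]
    by (auto split: if_splits)
  then have "ternary (\<lambda>n. b (Suc n)) = ternary (\<lambda>n. b' (Suc n))"
    using Suc.prems ternary_rec[of b] ternary_rec[of b'] by auto
  then show ?case by (rule Suc.IH)
qed

lemma ternary_close:
  "(\<And>i. i < n \<Longrightarrow> b i = b' i) \<Longrightarrow> \<bar>ternary b - ternary b'\<bar> \<le> 1 / 3 ^ n"
proof (induction n arbitrary: b b')
  case 0
  then show ?case
    using ternary_nonneg[of b] ternary_nonneg[of b'] ternary_le_1[of b] ternary_le_1[of b'] by auto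
next
  case (Suc n)
  have "\<bar>ternary (\<lambda>n. b (Suc n)) - ternary (\<lambda>n. b' (Suc n))\<bar> \<le> 1 / 3 ^ n"
    using Suc by auto
  moreover have "b 0 = b' 0" using Suc.prems by auto
  then have "ternary b - ternary b' = (ternary (\<lambda>n. b (Suc n)) - ternary (\<lambda>n. b' (Suc n))) / 3"
    using ternary_rec[of b] ternary_rec[of b'] by (simp add: field_simps)
  ultimately show ?case by simp
qed

text \<open>On the Cantor set this is the common left inverse of the two contractions in
  \<open>cantor_stage\<close>; the threshold 1/2 lies in the removed middle third, so it tells the
  two images apart.\<close>

definition unfold_cantor :: "real \<Rightarrow> real" where
  "unfold_cantor t = (if t \<ge> 1 / 2 then 3 * t - 2 else 3 * t)"

lemma cantor_stage_bounds: "t \<in> cantor_stage n \<Longrightarrow> 0 \<le> t \<and> t \<le> 1"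
proof (induction n arbitrary: t)
  case (Suc n)
  then show ?case by fastforce
qed simp

lemma unfold_cantor_in: "t \<in> cantor_set \<Longrightarrow> unfold_cantor t \<in> cantor_set"
  unfolding cantor_set_def
proof (rule INT_I)
  fix n assume "t \<in> \<Inter> (range cantor_stage)"
  then have "t \<in> cantor_stage (Suc n)" by blast
  then show "unfold_cantor t \<in> cantor_stage n"
    by (auto simp: unfold_cantor_def field_simps dest: cantor_stage_bounds)
qed

lemma cantor_set_ternary: "cantor_set = range ternary"
proof
  show "range ternary \<subseteq> cantor_set"
    unfolding cantor_set_def using ternary_in_stage by auto
  define digits where "digits t n \<longleftrightarrow> (unfold_cantor ^^ n) t \<ge> 1 / 2" for t n
  have digits_Suc: "(\<lambda>n. digits t (Suc n)) = digits (unfold_cantor t)" for t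
    unfolding digits_def by (simp add: funpow_swap1)
  \<comment> \<open>\<open>unfold_cantor\<close> triples the difference between a point and the
    value of its digits, and that difference never exceeds 1.\<close>
  have approx: "t \<in> cantor_set \<Longrightarrow> \<bar>t - ternary (digits t)\<bar> \<le> 1 / 3 ^ n" for t n
  proof (induction n arbitrary: t)
    case 0
    then have "t \<in> cantor_stage 0" unfolding cantor_set_def by blast
    then show ?case
      using ternary_nonneg[of "digits t"] ternary_le_1[of "digits t"] by auto
  next
    case (Suc n)
    have "\<bar>unfold_cantor t - ternary (digits (unfold_cantor t))\<bar> \<le> 1 / 3 ^ n"
      using Suc unfold_cantor_in by blast
    moreover have "ternary (digits t) = ((if t \<ge> 1 / 2 then 2 else 0) + ternary (digits (unfold_cantor t))) / 3"
      using ternary_rec[of "digits t"] unfolding digits_Suc by (simp add: digits_def)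
    then have "t - ternary (digits t) = (unfold_cantor t - ternary (digits (unfold_cantor t))) / 3"
      by (simp add: unfold_cantor_def field_simps)
    ultimately show ?case by simp
  qed
  show "cantor_set \<subseteq> range ternary"
  proof
    fix t assume "t \<in> cantor_set"
    have "(\<lambda>n. 1 / 3 ^ n :: real) \<longlonglongrightarrow> 0"
      using LIMSEQ_power_zero[of "1 / 3 :: real"] by (simp add: power_one_over)
    then have "\<bar>t - ternary (digits t)\<bar> \<le> 0"
      by (rule LIMSEQ_le_const) (use approx[OF \<open>t \<in> cantor_set\<close>] in auto)
    then show "t \<in> range ternary" by (intro range_eqI[of _ _ "digits t"]) simp
  qed
qed


section \<open>A recognition criterion for Cantor spaces\<close>

text \<open>Each cell is cut by the first clopen set of the family that cuts it properly, so a pair of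
  points separated by \<open>Q n\<close> lies in different cells after at most \<open>n + 1\<close> steps.\<close>

definition cutter :: "(nat \<Rightarrow> 'b set) \<Rightarrow> 'b set \<Rightarrow> nat" where
  "cutter Q D = (LEAST n. D \<inter> Q n \<noteq> {} \<and> D - Q n \<noteq> {})"

primrec cell :: "(nat \<Rightarrow> 'b set) \<Rightarrow> 'b set \<Rightarrow> (nat \<Rightarrow> bool) \<Rightarrow> nat \<Rightarrow> 'b set" where
  "cell Q T b 0 = T"
| "cell Q T b (Suc k) = (let D = cell Q T b k; S = Q (cutter Q D) in if b k then D \<inter> S else D - S)"

text \<open>Here the descent is steered by a point instead of a bit sequence, so that
  \<open>address\<close> can be read off from it; \<open>cell_address\<close> identifies the two
  descents.\<close>

primrec trace_cell :: "(nat \<Rightarrow> 'b set) \<Rightarrow> 'b set \<Rightarrow> 'b \<Rightarrow> nat \<Rightarrow> 'b set" where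
  "trace_cell Q T x 0 = T"
| "trace_cell Q T x (Suc k) =
    (let D = trace_cell Q T x k; S = Q (cutter Q D) in if x \<in> S then D \<inter> S else D - S)"

definition address :: "(nat \<Rightarrow> 'b set) \<Rightarrow> 'b set \<Rightarrow> 'b \<Rightarrow> nat \<Rightarrow> bool" where
  "address Q T x k \<longleftrightarrow> x \<in> Q (cutter Q (trace_cell Q T x k))"

lemma cell_address: "cell Q T (address Q T x) k = trace_cell Q T x k"
  by (induction k) (auto simp: Let_def address_def)

lemma in_trace_cell: "x \<in> T \<Longrightarrow> x \<in> trace_cell Q T x k"
  by (induction k) (auto simp: Let_def)

text \<open>The two pieces of a cut are disjoint, so lying in the cell at depth \<open>Suc j\<close>
  forces bit \<open>j\<close>. This serves both surjectivity (all depths) and continuity (depths up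
  to \<open>k\<close>) of the coding.\<close>

lemma address_unique:
  assumes "\<And>j. j \<le> k \<Longrightarrow> x \<in> cell Q T b j" "j < k"
  shows "address Q T x j = b j"
proof -
  have eq: "trace_cell Q T x i = cell Q T b i" if "i \<le> k" for i
    using that
  proof (induction i)
    case (Suc i)
    then show ?case using assms(1)[of "Suc i"] by (auto simp: Let_def split: if_splits)
  qed simp
  show ?thesis
    using eq[of j] assms(1)[of "Suc j"] assms(2)
    by (auto simp: Let_def address_def split: if_splits)
qed

lemma decseq_cell: "decseq (cell Q T b)"
  by (rule decseq_SucI) (auto simp: Let_def)

text \<open>This is Brouwer's characterisation of the Cantor set. The homeomorphism sends a point to
  the ternary value of its \<open>address\<close>; being a continuous bijection from a compact space
  to a Hausdorff space, it has a continuous inverse.\<close>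

theorem cantor_spaceI:
  fixes Q :: "nat \<Rightarrow> 'b set"
  assumes "compact_space X" and ne: "topspace X \<noteq> {}"
    and clopen: "\<And>n. openin X (Q n)" "\<And>n. closedin X (Q n)"
    and sep: "\<And>x y. x \<in> topspace X \<Longrightarrow> y \<in> topspace X \<Longrightarrow> x \<noteq> y \<Longrightarrow> \<exists>n. x \<in> Q n \<longleftrightarrow> y \<notin> Q n"
    and perfect: "\<And>x. x \<in> topspace X \<Longrightarrow> \<not> openin X {x}"
  shows "cantor_space X"
proof -
  define T where "T = topspace X"
  define E where "E = cell Q T"
  define cuts where "cuts D n \<longleftrightarrow> D \<inter> Q n \<noteq> {} \<and> D - Q n \<noteq> {}" for D n
  have cutter: "cutter Q D = (LEAST n. cuts D n)" for D
    unfolding cutter_def cuts_def ..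
  \<comment> \<open>By \<open>perfect\<close> a nonempty open set has two points, and a member of
    the family separating them cuts it. So the \<open>LEAST\<close> in \<open>cutter\<close> is
    attained, and both pieces of every cut are nonempty.\<close>
  have cut: "cuts D (cutter Q D)" if D: "openin X D" "D \<noteq> {}" for D
  proof -
    obtain x where x: "x \<in> D" using D by blast
    have "x \<in> topspace X" using x D openin_subset by blast
    then have "D \<noteq> {x}" using perfect D(1) by metis
    then obtain y where y: "y \<in> D" "y \<noteq> x" using x by blast
    obtain n where "x \<in> Q n \<longleftrightarrow> y \<notin> Q n"
      using sep[of x y] x y openin_subset[OF D(1)] by blast
    then have "cuts D n" using x y unfolding cuts_def by blast
    then show ?thesis unfolding cutter by (rule LeastI)
  qed
  have E: "openin X (E b k) \<and> closedin X (E b k) \<and> E b k \<noteq> {}" for b k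
  proof (induction k)
    case 0
    then show ?case using ne by (simp add: E_def T_def)
  next
    case (Suc k)
    let ?D = "E b k" and ?S = "Q (cutter Q (E b k))"
    have "cuts ?D (cutter Q ?D)" using cut Suc by blast
    moreover have "E b (Suc k) = (if b k then ?D \<inter> ?S else ?D - ?S)"
      unfolding E_def by (simp add: Let_def)
    ultimately show ?case
      using Suc clopen unfolding cuts_def by (simp add: openin_diff closedin_diff openin_Int closedin_Int)
  qed
  have in_E: "x \<in> E (address Q T x) k" if "x \<in> T" for x k
    unfolding E_def cell_address using that by (rule in_trace_cell)
  have address_eqD: "x = y" if xy: "x \<in> T" "y \<in> T" "address Q T x = address Q T y" for x y
  proof (rule ccontr)
    assume "x \<noteq> y"
    then obtain n where n: "x \<in> Q n \<longleftrightarrow> y \<notin> Q n" using sep xy unfolding T_def by blast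
    define D where "D = E (address Q T x)"
    have xD: "x \<in> D k" and yD: "y \<in> D k" for k
      using in_E xy unfolding D_def by metis+
    have cn: "cutter Q (D k) \<le> n" for k
      unfolding cutter by (rule Least_le) (use n xD[of k] yD[of k] in \<open>auto simp: cuts_def\<close>)
    \<comment> \<open>Whatever cuts the smaller cell also cuts the larger one, whence \<le>; the set
      just used no longer cuts the smaller cell, whence inequality. Strict growth contradicts the
      bound \<open>n\<close> from \<open>cn\<close>.\<close>
    have "cutter Q (D k) < cutter Q (D (Suc k))" for k
    proof -
      have c: "cuts (D (Suc k)) (cutter Q (D (Suc k)))"
        using cut E unfolding D_def by blast
      have D: "D (Suc k) = (if address Q T x k then D k \<inter> Q (cutter Q (D k)) else D k - Q (cutter Q (D k)))"
        unfolding D_def E_def by (simp add: Let_def)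
      have "cuts (D k) (cutter Q (D (Suc k)))"
        using c D unfolding cuts_def by (auto split: if_splits)
      then have "cutter Q (D k) \<le> cutter Q (D (Suc k))"
        unfolding cutter[of "D k"] by (rule Least_le)
      moreover have "cutter Q (D k) \<noteq> cutter Q (D (Suc k))"
        using c D unfolding cuts_def by (auto split: if_splits)
      ultimately show ?thesis by simp
    qed
    then have "strict_mono (\<lambda>k. cutter Q (D k))" by (simp add: strict_mono_Suc_iff)
    then have "Suc n \<le> cutter Q (D (Suc n))" by (rule strict_mono_imp_increasing)
    then show False using cn[of "Suc n"] by simp
  qed
  define \<phi> where "\<phi> x = ternary (address Q T x)" for x
  have inj: "inj_on \<phi> T"
    using address_eqD ternary_eqD unfolding \<phi>_def by (intro inj_onI) blast
  have img: "\<phi> ` T = cantor_set"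
  proof
    show "\<phi> ` T \<subseteq> cantor_set" unfolding \<phi>_def cantor_set_ternary by auto
    show "cantor_set \<subseteq> \<phi> ` T"
    proof
      fix t assume "t \<in> cantor_set"
      then obtain b where t: "t = ternary b" unfolding cantor_set_ternary by blast
      \<comment> \<open>Compactness makes every bit sequence occur: its cells are nested, closed and
        nonempty.\<close>
      have "(\<Inter>k. E b k) \<noteq> {}"
        using compact_space_imp_nest[OF assms(1), of "E b"] E decseq_cell unfolding E_def by blast
      then obtain x where x: "\<And>k. x \<in> E b k" by blast
      have "address Q T x = b"
        by (rule ext, rule address_unique[of "Suc k" for k]) (use x in \<open>auto simp: E_def\<close>)
      moreover have "x \<in> T" using x[of 0] by (simp add: E_def)
      ultimately show "t \<in> \<phi> ` T" unfolding \<phi>_def t by blast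
    qed
  qed
  have "continuous_map X euclidean \<phi>"
    unfolding mtopology_is_euclidean[symmetric] Met_TC.continuous_map_to_metric
  proof (intro ballI allI impI)
    fix x and \<epsilon> :: real assume x: "x \<in> topspace X" and "\<epsilon> > 0"
    then have "\<exists>k. (1 / 3) ^ k < \<epsilon>" by (intro real_arch_pow_inv) simp_all
    then obtain k where k: "(1 / 3) ^ k < \<epsilon>" by blast
    have "dist (\<phi> x) (\<phi> y) < \<epsilon>" if y: "y \<in> E (address Q T x) k" for y
    proof -
      have "address Q T y j = address Q T x j" if "j < k" for j
      proof (rule address_unique[OF _ that])
        fix i assume "i \<le> k"
        then show "y \<in> cell Q T (address Q T x) i"
          using y decseqD[OF decseq_cell \<open>i \<le> k\<close>, of Q T "address Q T x"]
          unfolding E_def by blast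
      qed
      then have "\<bar>\<phi> x - \<phi> y\<bar> \<le> 1 / 3 ^ k"
        unfolding \<phi>_def by (intro ternary_close) auto
      then show ?thesis using k by (simp add: dist_real_def power_one_over)
    qed
    then show "\<exists>U. openin X U \<and> x \<in> U \<and> (\<forall>y\<in>U. \<phi> y \<in> Met_TC.mball (\<phi> x) \<epsilon>)"
      using E[of "address Q T x" k] in_E[of x k] x unfolding T_def[symmetric] mball_eq_ball mem_ball
      by blast
  qed
  then have "continuous_map X (top_of_set cantor_set) \<phi>"
    using img by (auto simp: continuous_map_in_subtopology T_def)
  then have "homeomorphic_map X (top_of_set cantor_set) \<phi>"
    using assms(1) img inj
    by (intro continuous_imp_homeomorphic_map Hausdorff_space_subtopology Hausdorff_space_euclidean)
      (auto simp: T_def)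
  then show ?thesis
    unfolding cantor_space_def by (rule homeomorphic_map_imp_homeomorphic_space)
qed


section \<open>Coarse components\<close>

lemma coarse_rel_in: "(x, y) \<in> coarse_rel \<mu> S \<Longrightarrow> x \<in> S \<and> y \<in> S"
  using equiv_coarse_rel[of S \<mu>] unfolding equiv_def by blast

lemma coarse_rel_refl: "x \<in> S \<Longrightarrow> (x, x) \<in> coarse_rel \<mu> S"
  using equiv_coarse_rel[of S \<mu>] by (meson equivE refl_onD)

lemma coarse_rel_sym: "(x, y) \<in> coarse_rel \<mu> S \<Longrightarrow> (y, x) \<in> coarse_rel \<mu> S"
  using equiv_coarse_rel[of S \<mu>] by (meson equivE symD)

lemma coarse_rel_trans:
  "(x, y) \<in> coarse_rel \<mu> S \<Longrightarrow> (y, z) \<in> coarse_rel \<mu> S \<Longrightarrow> (x, z) \<in> coarse_rel \<mu> S"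
  using equiv_coarse_rel[of S \<mu>] by (meson equivE transD)

lemma coarse_rel_edge:
  assumes "x \<in> S" "y \<in> S" "dist x y \<le> \<mu>"
  shows "(x, y) \<in> coarse_rel \<mu> S"
  by (rule coarse_relI[of "\<lambda>k. if k = 0 then x else y" x 1]) (use assms in auto)

lemma coarse_rel_subset:
  "(x, y) \<in> coarse_rel \<mu> S \<Longrightarrow> \<mu> \<le> \<nu> \<Longrightarrow> S \<subseteq> T \<Longrightarrow> (x, y) \<in> coarse_rel \<nu> T"
  using coarse_rel_mono by blast

lemma coarse_rel_induct [consumes 1, case_names base step]:
  assumes "(x, y) \<in> coarse_rel \<mu> S" "P x"
    and step: "\<And>y z. (x, y) \<in> coarse_rel \<mu> S \<Longrightarrow> P y \<Longrightarrow> y \<in> S \<Longrightarrow> z \<in> S \<Longrightarrow> dist y z \<le> \<mu> \<Longrightarrow> P z"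
  shows "P y"
proof -
  obtain n :: nat and p where p: "p 0 = x" "p n = y" "\<And>k. k \<le> n \<Longrightarrow> p k \<in> S"
    "\<And>k. k \<in> {1..n} \<Longrightarrow> dist (p (k - 1)) (p k) \<le> \<mu>"
    using assms(1) by (rule coarse_relE) blast
  have "k \<le> n \<Longrightarrow> (x, p k) \<in> coarse_rel \<mu> S \<and> P (p k)" for k
  proof (induction k)
    case 0
    then show ?case using p(1) p(3)[of 0] assms(2) by (auto intro: coarse_rel_refl)
  next
    case (Suc k)
    then have *: "(x, p k) \<in> coarse_rel \<mu> S" "P (p k)" "p k \<in> S" "p (Suc k) \<in> S" "dist (p k) (p (Suc k)) \<le> \<mu>"
      using p(3)[of k] p(3)[of "Suc k"] p(4)[of "Suc k"] by auto
    then show ?case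
      using step[OF *] coarse_rel_trans[OF *(1) coarse_rel_edge[OF *(3-5)]] by blast
  qed
  then show ?thesis using p(2) by blast
qed

lemma coarse_rel_map:
  assumes "(x, y) \<in> coarse_rel \<mu> S"
    and "\<And>u v. u \<in> S \<Longrightarrow> v \<in> S \<Longrightarrow> dist u v \<le> \<mu> \<Longrightarrow> (k u, k v) \<in> coarse_rel \<nu> T"
    and "\<And>u. u \<in> S \<Longrightarrow> k u \<in> T"
  shows "(k x, k y) \<in> coarse_rel \<nu> T"
  using assms(1)
proof (induction rule: coarse_rel_induct)
  case base
  then show ?case using assms(1,3) coarse_rel_in by (blast intro: coarse_rel_refl)
next
  case (step y z)
  then show ?case using assms(2) coarse_rel_trans by blast
qed

text \<open>The chain is stopped just before it first enters \<open>B\<close>. In the induction the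
  second disjunct stands for a chain that has not yet entered; at the endpoint it contradicts
  \<open>w \<in> B\<close>.\<close>

lemma coarse_rel_exit:
  assumes "(z, w) \<in> coarse_rel \<mu> UNIV" "z \<notin> B" "w \<in> B"
  obtains u v where "(z, u) \<in> coarse_rel \<mu> (- B)" "v \<in> B" "dist u v \<le> \<mu>"
proof -
  have "(\<exists>u v. (z, u) \<in> coarse_rel \<mu> (- B) \<and> v \<in> B \<and> dist u v \<le> \<mu>) \<or> (z, w) \<in> coarse_rel \<mu> (- B)"
    using assms(1)
  proof (induction rule: coarse_rel_induct)
    case base
    then show ?case using assms(2) by (auto intro: coarse_rel_refl)
  next
    case (step u v)
    show ?case
    proof (cases "(z, u) \<in> coarse_rel \<mu> (- B) \<and> v \<notin> B")
      case True
      then have "(u, v) \<in> coarse_rel \<mu> (- B)"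
        using step coarse_rel_in by (blast intro: coarse_rel_edge)
      then show ?thesis using True coarse_rel_trans by blast
    qed (use step in blast)
  qed
  then show ?thesis using that assms(3) coarse_rel_in by blast
qed

lemma component_eq:
  assumes "V \<in> coarse_components \<mu> S" "v \<in> V"
  shows "V = coarse_rel \<mu> S `` {v}"
  using assms unfolding coarse_components_def
  by (metis Image_singleton_iff equiv_class_eq_iff equiv_coarse_rel quotientE)

lemma unbounded_componentD:
  assumes "V \<in> unbounded_components \<mu> B"
  shows "\<not> bounded V" "V \<noteq> {}" "V \<inter> B = {}" "v \<in> V \<Longrightarrow> V = coarse_rel \<mu> (- B) `` {v}"
proof -
  show "\<not> bounded V" using assms unfolding unbounded_components_def by blast
  then show "V \<noteq> {}" by auto
  show *: "V = coarse_rel \<mu> (- B) `` {v}" if "v \<in> V" for v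
    using assms component_eq that unfolding unbounded_components_def by blast
  show "V \<inter> B = {}" using * coarse_rel_in by fastforce
qed

lemma unbounded_componentI:
  "v \<notin> B \<Longrightarrow> \<not> bounded (coarse_rel \<mu> (- B) `` {v}) \<Longrightarrow> coarse_rel \<mu> (- B) `` {v} \<in> unbounded_components \<mu> B"
  unfolding unbounded_components_def coarse_components_def by (auto intro: quotientI)

lemma component_rel:
  "V \<in> unbounded_components \<mu> B \<Longrightarrow> v \<in> V \<Longrightarrow> w \<in> V \<longleftrightarrow> (v, w) \<in> coarse_rel \<mu> (- B)"
  using unbounded_componentD(4) by blast

lemma component_inter:
  "V \<in> unbounded_components \<mu> B \<Longrightarrow> W \<in> unbounded_components \<mu> B \<Longrightarrow> x \<in> V \<Longrightarrow> x \<in> W \<Longrightarrow> V = W"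
  using unbounded_componentD(4) by metis

lemma component_subset:
  assumes "U \<in> unbounded_components \<mu> C" "V \<in> unbounded_components \<nu> B" "x \<in> U" "x \<in> V"
    and "\<mu> \<le> \<nu>" "B \<subseteq> C"
  shows "U \<subseteq> V"
proof
  fix y assume "y \<in> U"
  then have "(x, y) \<in> coarse_rel \<mu> (- C)" using assms component_rel by blast
  then have "(x, y) \<in> coarse_rel \<nu> (- B)" by (rule coarse_rel_subset) (use assms in auto)
  then show "y \<in> V" using assms component_rel by blast
qed

text \<open>Compatibility is freed from the definite description in \<open>component_map\<close>: an
  inclusion between components can be established by exhibiting one common point, through
  \<open>component_subset\<close>.\<close>

lemma coarse_threads_iff:
  "e \<in> coarse_threads \<mu> \<longleftrightarrow> e \<in> extensional {B. bounded B} \<and>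
     (\<forall>B. bounded B \<longrightarrow> e B \<in> unbounded_components \<mu> B) \<and>
     (\<forall>B C. bounded C \<longrightarrow> B \<subseteq> C \<longrightarrow> e C \<subseteq> e B)"
  (is "?L \<longleftrightarrow> ?R")
proof
  assume e: ?L
  have "e C \<subseteq> e B" if "bounded C" "B \<subseteq> C" for B C
    using component_map(2)[OF coarse_threadsD[OF e that(1)] order_refl that(2)] e that
    unfolding coarse_threads_def by auto
  then show ?R using e unfolding coarse_threads_def by (auto simp: PiE_def)
next
  assume e: ?R
  have "component_map \<mu> B (e C) = e B" if "bounded C" "B \<subseteq> C" for B C
    using e that bounded_subset by (intro component_map_eqI[of "e C" \<mu> C]) auto
  then show ?L using e unfolding coarse_threads_def by (auto simp: PiE_def)
qed

lemma coarse_threads_mono: "e \<in> coarse_threads \<mu> \<Longrightarrow> bounded C \<Longrightarrow> B \<subseteq> C \<Longrightarrow> e C \<subseteq> e B"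
  unfolding coarse_threads_iff by blast

lemma coarse_threads_component_map:
  assumes "e \<in> coarse_threads \<mu>" "bounded C" "B \<subseteq> C"
  shows "component_map \<mu> B (e C) = e B"
proof -
  have "\<forall>B C. bounded C \<and> B \<subseteq> C \<longrightarrow> component_map \<mu> B (e C) = e B"
    using assms(1) unfolding coarse_threads_def mem_Collect_eq by (rule conjunct2)
  from this[rule_format, OF conjI[OF assms(2,3)]] show ?thesis .
qed

lemma coarse_threads_eq_mono:
  assumes "e \<in> coarse_threads \<mu>" "e' \<in> coarse_threads \<mu>" "bounded C" "B \<subseteq> C" "e C = e' C"
  shows "e B = e' B"
  using coarse_threads_component_map[OF assms(1,3,4)] coarse_threads_component_map[OF assms(2,3,4)]
    assms(5) by simp

lemma coarse_threads_eqI: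
  assumes "e \<in> coarse_threads \<mu>" "e' \<in> coarse_threads \<mu>" "\<And>B. bounded B \<Longrightarrow> e B = e' B"
  shows "e = e'"
  using assms unfolding coarse_threads_iff by (auto intro: extensionalityI)

definition thicken :: "'a::metric_space set \<Rightarrow> real \<Rightarrow> 'a set" where
  "thicken B t = (\<Union>y\<in>B. cball y t)"

lemma bounded_thicken: "bounded B \<Longrightarrow> bounded (thicken B t)"
proof -
  assume "bounded B"
  then obtain x r where r: "\<And>y. y \<in> B \<Longrightarrow> dist x y \<le> r" unfolding bounded_def by blast
  have "dist x z \<le> r + t" if z: "z \<in> thicken B t" for z
  proof -
    obtain y where "y \<in> B" "dist y z \<le> t" using z unfolding thicken_def by auto
    then show ?thesis using r[of y] dist_triangle[of x z y] by linarith
  qed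
  then show ?thesis unfolding bounded_def by blast
qed

lemma thicken_superset: "0 \<le> t \<Longrightarrow> B \<subseteq> thicken B t"
  unfolding thicken_def by auto

lemma thicken_mono: "B \<subseteq> C \<Longrightarrow> s \<le> t \<Longrightarrow> thicken B s \<subseteq> thicken C t"
  unfolding thicken_def by force

lemma thicken_cball: "thicken (cball x r) t \<subseteq> cball x (r + t)"
proof
  fix z assume "z \<in> thicken (cball x r) t"
  then obtain y where "dist x y \<le> r" "dist y z \<le> t" unfolding thicken_def by auto
  then show "z \<in> cball x (r + t)" using dist_triangle[of x z y] by simp
qed


section \<open>Finiteness of the unbounded components and extension of components to threads\<close>

lemma unbounded_far:
  fixes S :: "'a::metric_space set"
  assumes "\<not> bounded S"
  obtains v where "v \<in> S" "n < dist x0 v"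
  using assms unfolding bounded_def by (metis not_le)

lemma bounded_in_cball: "bounded B \<Longrightarrow> \<exists>n::nat. B \<subseteq> cball x0 (real n)"
proof -
  assume "bounded B"
  then obtain r where "\<forall>y\<in>B. dist x0 y \<le> r" unfolding bounded_any_center[of B x0] by blast
  moreover obtain n :: nat where "r \<le> real n" using real_arch_simple by blast
  ultimately show ?thesis by (intro exI[of _ n]) force
qed

text \<open>\<open>chain\<close> is quasi-convexity in the form used below: a chain of total length
  at most \<open>a * dist x y + b\<close> cannot leave that ball around its start.
  \<open>R \<le> \<mu>\<close> makes the passage to a nearby point of \<open>\<Gamma>\<close> an
  admissible jump.\<close>

locale coarse_geometry =
  fixes \<Gamma> :: "'a::metric_space set" and R a b \<mu> :: real
  assumes R_nonneg: "0 \<le> R" and R_le: "R \<le> \<mu>" and mu_pos: "0 < \<mu>"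
    and a_nonneg: "0 \<le> a" and b_nonneg: "0 \<le> b"
    and net: "\<exists>y\<in>\<Gamma>. dist x y \<le> R"
    and finite_net: "0 \<le> r \<Longrightarrow> finite (cball x r \<inter> \<Gamma>)"
    and chain: "(x, y) \<in> coarse_rel \<mu> (cball (x :: 'a) (a * dist x y + b))"
begin

lemma coarsely_connected: "(x :: 'a, y) \<in> coarse_rel \<mu> UNIV"
  by (rule coarse_rel_subset[OF chain order_refl]) simp

text \<open>Each \<open>\<nu>\<close>-jump starting outside \<open>D\<close> is replaced by a
  \<open>\<mu>\<close>-chain that stays within \<open>a * \<nu> + b\<close> of its starting point
  and hence misses \<open>B\<close>.\<close>

lemma coarse_rel_shrink:
  fixes x y :: 'a
  assumes "(x, y) \<in> coarse_rel \<nu> (- D)" "thicken B (a * \<nu> + b) \<subseteq> D" "0 \<le> \<nu>"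
  shows "(x, y) \<in> coarse_rel \<mu> (- B)"
proof -
  have nonneg: "0 \<le> a * \<nu> + b" using a_nonneg b_nonneg assms(3) by simp
  have "((\<lambda>x. x) x, (\<lambda>x. x) y) \<in> coarse_rel \<mu> (- B)"
  proof (rule coarse_rel_map[OF assms(1)])
    fix u v assume uv: "u \<in> - D" "v \<in> - D" "dist u v \<le> \<nu>"
    have "a * dist u v + b \<le> a * \<nu> + b" using uv(3) a_nonneg by (simp add: mult_left_mono)
    then have "cball u (a * dist u v + b) \<subseteq> - B"
    proof (intro subsetI ComplI)
      fix w assume w: "w \<in> cball u (a * dist u v + b)" "w \<in> B"
      then have "dist w u \<le> a * \<nu> + b"
        using \<open>a * dist u v + b \<le> a * \<nu> + b\<close> by (simp add: dist_commute)
      then have "u \<in> thicken B (a * \<nu> + b)" using w(2) unfolding thicken_def by auto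
      then show False using uv(1) assms(2) by blast
    qed
    then show "(u, v) \<in> coarse_rel \<mu> (- B)" by (rule coarse_rel_subset[OF chain order_refl])
  next
    fix u assume "u \<in> - D"
    then show "u \<in> - B" using thicken_superset[OF nonneg, of B] assms(2) by blast
  qed
  then show ?thesis by simp
qed

text \<open>A chain from such a component towards \<open>x0\<close> is stopped just outside
  \<open>cball x0 (n + R)\<close>, at distance at most \<open>n + R + \<mu>\<close>. A net point
  within \<open>R\<close> is then still outside \<open>B\<close>, hence in the same component, and
  lies in \<open>cball x0 (n + 2 * R + \<mu>)\<close>. That ball has finitely many net points, each
  of which determines its component.\<close>

lemma finite_far_components:
  fixes x0 :: 'a
  assumes "B \<subseteq> cball x0 n"
  shows "finite {V \<in> coarse_components \<mu> (- B). \<exists>v\<in>V. n + R < dist x0 v}"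
proof (cases "0 \<le> n")
  case True
  have "\<exists>\<gamma>\<in>cball x0 (n + 2 * R + \<mu>) \<inter> \<Gamma>. V = coarse_rel \<mu> (- B) `` {\<gamma>}"
    if V: "V \<in> coarse_components \<mu> (- B)" "v \<in> V" "n + R < dist x0 v" for V v
  proof -
    obtain u w where u: "(v, u) \<in> coarse_rel \<mu> (- cball x0 (n + R))" "w \<in> cball x0 (n + R)" "dist u w \<le> \<mu>"
      by (rule coarse_rel_exit[OF coarsely_connected[of v x0], of "cball x0 (n + R)"])
        (use V True R_nonneg in auto)
    have "(v, u) \<in> coarse_rel \<mu> (- B)"
      using u(1) by (rule coarse_rel_subset) (use assms R_nonneg in auto)
    have du: "dist x0 u > n + R" using coarse_rel_in[OF u(1)] by auto
    obtain \<gamma> where \<gamma>: "\<gamma> \<in> \<Gamma>" "dist u \<gamma> \<le> R" using net by blast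
    have "dist x0 \<gamma> > n"
      using du \<gamma>(2) dist_triangle[of x0 u \<gamma>] by (simp add: dist_commute)
    then have "\<gamma> \<notin> B" using assms by auto
    moreover have "u \<notin> B" using \<open>(v, u) \<in> coarse_rel \<mu> (- B)\<close> coarse_rel_in by blast
    ultimately have "(u, \<gamma>) \<in> coarse_rel \<mu> (- B)"
      using \<gamma> R_le by (intro coarse_rel_edge) auto
    then have "(v, \<gamma>) \<in> coarse_rel \<mu> (- B)"
      using \<open>(v, u) \<in> coarse_rel \<mu> (- B)\<close> coarse_rel_trans by blast
    then have "\<gamma> \<in> V" using component_eq[OF V(1,2)] by blast
    then have "V = coarse_rel \<mu> (- B) `` {\<gamma>}" using component_eq[OF V(1)] by blast
    moreover have "dist x0 \<gamma> \<le> n + 2 * R + \<mu>"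
      using u(2,3) \<gamma>(2) dist_triangle[of x0 \<gamma> u] dist_triangle[of x0 u w]
      by (simp add: dist_commute)
    ultimately show ?thesis using \<gamma>(1) by auto
  qed
  then have "{V \<in> coarse_components \<mu> (- B). \<exists>v\<in>V. n + R < dist x0 v}
      \<subseteq> (\<lambda>\<gamma>. coarse_rel \<mu> (- B) `` {\<gamma>}) ` (cball x0 (n + 2 * R + \<mu>) \<inter> \<Gamma>)"
    by blast
  then show ?thesis
    by (rule finite_subset) (use finite_net True R_nonneg mu_pos in auto)
next
  case False
  then have "B = {}" using assms by auto
  have "V = UNIV" if "V \<in> coarse_components \<mu> (- B)" for V
    using that coarsely_connected unfolding \<open>B = {}\<close> coarse_components_def by (auto elim!: quotientE)
  then have "{V \<in> coarse_components \<mu> (- B). \<exists>v\<in>V. n + R < dist x0 v} \<subseteq> {UNIV}" by blast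
  then show ?thesis by (rule finite_subset) simp
qed

lemma finite_unbounded_components:
  fixes B :: "'a set"
  assumes "bounded B"
  shows "finite (unbounded_components \<mu> B)"
proof -
  fix x0 :: 'a
  obtain n :: nat where n: "B \<subseteq> cball x0 (real n)" using bounded_in_cball assms by blast
  show ?thesis
  proof (rule finite_subset[OF _ finite_far_components[OF n]], rule subsetI)
    fix V assume V: "V \<in> unbounded_components \<mu> B"
    obtain v where "v \<in> V" "real n + R < dist x0 v"
      using unbounded_far[OF unbounded_componentD(1)[OF V]] by blast
    then show "V \<in> {V \<in> coarse_components \<mu> (- B). \<exists>v\<in>V. real n + R < dist x0 v}"
      using V unfolding unbounded_components_def by blast
  qed
qed

text \<open>Pigeonhole: up to a bounded part, \<open>S\<close> is covered by finitely many
  components, so its trace on one of them is unbounded, and that component is then unbounded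
  too.\<close>

lemma unbounded_component_meets:
  fixes B S :: "'a set"
  assumes "\<not> bounded S" "bounded B"
  obtains V where "V \<in> unbounded_components \<mu> B" "\<not> bounded (V \<inter> S)"
proof -
  fix x0 :: 'a
  obtain n :: nat where n: "B \<subseteq> cball x0 (real n)" using bounded_in_cball assms by blast
  define F where "F = {V \<in> coarse_components \<mu> (- B). \<exists>v\<in>V. real n + R < dist x0 v}"
  have fin: "finite F" unfolding F_def by (rule finite_far_components[OF n])
  have "S \<subseteq> cball x0 (real n + R) \<union> (\<Union>V\<in>F. V \<inter> S)"
  proof
    fix s assume s: "s \<in> S"
    show "s \<in> cball x0 (real n + R) \<union> (\<Union>V\<in>F. V \<inter> S)"
    proof (cases "dist x0 s \<le> real n + R")
      case False
      then have "s \<notin> B" using n R_nonneg by force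
      then have "s \<in> coarse_rel \<mu> (- B) `` {s}" by (auto intro: coarse_rel_refl)
      moreover have "coarse_rel \<mu> (- B) `` {s} \<in> coarse_components \<mu> (- B)"
        unfolding coarse_components_def using \<open>s \<notin> B\<close> by (auto intro: quotientI)
      ultimately have "coarse_rel \<mu> (- B) `` {s} \<in> F" "s \<in> coarse_rel \<mu> (- B) `` {s}"
        using False not_le unfolding F_def by blast+
      then show ?thesis using s by blast
    qed auto
  qed
  then have "\<not> bounded (\<Union>V\<in>F. V \<inter> S)"
    using assms(1) bounded_subset[of "cball x0 (real n + R) \<union> (\<Union>V\<in>F. V \<inter> S)" S]
      bounded_Un[of "cball x0 (real n + R)" "\<Union>V\<in>F. V \<inter> S"] bounded_cball[of x0 "real n + R"]
    by blast
  then obtain V where V: "V \<in> F" "\<not> bounded (V \<inter> S)"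
    using fin by (meson bounded_UN)
  then have "V \<in> unbounded_components \<mu> B"
    using bounded_subset[of V "V \<inter> S"] unfolding F_def unbounded_components_def by blast
  then show ?thesis using V(2) by (rule that)
qed

text \<open>This is surjectivity of the bonding maps of the inverse system, obtained by applying the
  pigeonhole to \<open>V\<close> itself.\<close>

lemma unbounded_component_refine:
  fixes C D V :: "'a set"
  assumes "V \<in> unbounded_components \<mu> C" "bounded D" "C \<subseteq> D"
  obtains W where "W \<in> unbounded_components \<mu> D" "W \<subseteq> V"
proof -
  obtain W where W: "W \<in> unbounded_components \<mu> D" "\<not> bounded (W \<inter> V)"
    using unbounded_component_meets[OF unbounded_componentD(1)[OF assms(1)] assms(2)] .
  then obtain x where "x \<in> W" "x \<in> V" by (metis bounded_empty disjoint_iff)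
  then have "W \<subseteq> V" using component_subset[OF W(1) assms(1)] assms by auto
  with W(1) show ?thesis by (rule that)
qed

text \<open>Surjective bonding maps along a cofinal sequence of bounded sets, here the sets
  \<open>C \<union> cball x0 (real n)\<close>, let a decreasing sequence of components be chosen
  inside \<open>V\<close>.\<close>

lemma thread_through:
  fixes C V :: "'a set"
  assumes V: "V \<in> unbounded_components \<mu> C" and "bounded C"
  obtains e where "e \<in> coarse_threads \<mu>" "e C = V"
proof -
  fix x0 :: 'a
  define D where "D n = C \<union> cball x0 (real n)" for n :: nat
  have bD: "bounded (D n)" for n using assms unfolding D_def by simp
  have DD: "m \<le> n \<Longrightarrow> D m \<subseteq> D n" for m n unfolding D_def by auto
  have Dex: "\<exists>n. B \<subseteq> D n" if "bounded B" for B
    using bounded_in_cball[OF that, of x0] unfolding D_def by blast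
  have "\<exists>W. \<forall>n. (W n \<in> unbounded_components \<mu> (D n) \<and> W n \<subseteq> V) \<and> W (Suc n) \<subseteq> W n"
  proof (rule dependent_nat_choice)
    have "C \<subseteq> D 0" unfolding D_def by blast
    then obtain U where "U \<in> unbounded_components \<mu> (D 0)" "U \<subseteq> V"
      by (rule unbounded_component_refine[OF V bD[of 0]])
    then show "\<exists>U. U \<in> unbounded_components \<mu> (D 0) \<and> U \<subseteq> V" by blast
    fix U n assume U: "U \<in> unbounded_components \<mu> (D n) \<and> U \<subseteq> V"
    have "D n \<subseteq> D (Suc n)" by (rule DD) simp
    then obtain U' where "U' \<in> unbounded_components \<mu> (D (Suc n))" "U' \<subseteq> U"
      by (rule unbounded_component_refine[OF conjunct1[OF U] bD[of "Suc n"]])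
    then show "\<exists>U'. (U' \<in> unbounded_components \<mu> (D (Suc n)) \<and> U' \<subseteq> V) \<and> U' \<subseteq> U"
      using U by blast
  qed
  then obtain W where W: "\<And>n. W n \<in> unbounded_components \<mu> (D n)" "\<And>n. W n \<subseteq> V" "\<And>n. W (Suc n) \<subseteq> W n"
    by blast
  have WW: "m \<le> n \<Longrightarrow> W n \<subseteq> W m" for m n
    using decseqD[OF decseq_SucI[of W]] W(3) by blast
  \<comment> \<open>The value at \<open>B\<close> is the component containing \<open>W n\<close> for
    the first \<open>D n\<close> that covers \<open>B\<close>; every later \<open>n\<close> gives
    the same component, since the \<open>W n\<close> decrease.\<close>
  define e where "e = (\<lambda>B\<in>{B. bounded B}. component_map \<mu> B (W (LEAST n. B \<subseteq> D n)))"
  have e: "e B \<in> unbounded_components \<mu> B" "B \<subseteq> D n \<Longrightarrow> W n \<subseteq> e B" if B: "bounded B" for B n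
  proof -
    define m where "m = (LEAST n. B \<subseteq> D n)"
    have m: "B \<subseteq> D m" unfolding m_def using LeastI_ex[OF Dex[OF B]] .
    have eB: "e B = component_map \<mu> B (W m)" using B unfolding e_def m_def by simp
    show "e B \<in> unbounded_components \<mu> B"
      unfolding eB by (rule component_map(1)[OF W(1) order_refl m])
    assume "B \<subseteq> D n"
    then have "m \<le> n" unfolding m_def by (rule Least_le)
    then show "W n \<subseteq> e B"
      unfolding eB using component_map(2)[OF W(1) order_refl m] WW order_trans by blast
  qed
  have "e C' \<subseteq> e B" if C': "bounded C'" "B \<subseteq> C'" for B C'
  proof -
    have B: "bounded B" using bounded_subset[OF C'] .
    obtain n where n: "C' \<subseteq> D n" using Dex C'(1) by blast
    have "W n \<subseteq> e C'" "W n \<subseteq> e B"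
      using e(2)[OF C'(1) n] e(2)[OF B order_trans[OF C'(2) n]] .
    moreover obtain x where "x \<in> W n" using unbounded_componentD(2)[OF W(1)] by blast
    ultimately show ?thesis
      using C'(2) by (intro component_subset[OF e(1)[OF C'(1)] e(1)[OF B], of x]) auto
  qed
  moreover have "e \<in> extensional {B. bounded B}" unfolding e_def by simp
  ultimately have "e \<in> coarse_threads \<mu>"
    unfolding coarse_threads_iff using e(1) by blast
  moreover have "e C = V"
  proof -
    have "W 0 \<subseteq> e C" using e(2)[OF assms(2), of 0] unfolding D_def by blast
    moreover obtain x where "x \<in> W 0" using unbounded_componentD(2)[OF W(1)] by blast
    ultimately show ?thesis
      using W(2)[of 0] by (intro component_inter[OF e(1)[OF assms(2)] V, of x]) blast+
  qed
  ultimately show ?thesis by (rule that)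
qed

end


section \<open>The topology of the space of ends\<close>

lemma continuous_map_thread_eval:
  assumes "bounded B"
  shows "continuous_map (coarse_ends_at \<nu>) (discrete_topology (unbounded_components \<nu> B)) (\<lambda>e. e B)"
  unfolding coarse_ends_at_def
  using assms by (intro continuous_map_from_subtopology continuous_map_product_projection) simp

lemma clopen_thread_eval:
  assumes "bounded B"
  shows "openin (coarse_ends_at \<nu>) {e \<in> coarse_threads \<nu>. e B \<in> F}"
    and "closedin (coarse_ends_at \<nu>) {e \<in> coarse_threads \<nu>. e B \<in> F}"
proof -
  have eq: "{e \<in> coarse_threads \<nu>. e B \<in> F} =
      {e \<in> topspace (coarse_ends_at \<nu>). e B \<in> F \<inter> unbounded_components \<nu> B}"
    using coarse_threadsD[OF _ assms] by auto
  show "openin (coarse_ends_at \<nu>) {e \<in> coarse_threads \<nu>. e B \<in> F}"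
    unfolding eq by (rule openin_continuous_map_preimage[OF continuous_map_thread_eval[OF assms]]) simp
  show "closedin (coarse_ends_at \<nu>) {e \<in> coarse_threads \<nu>. e B \<in> F}"
    unfolding eq by (rule closedin_continuous_map_preimage[OF continuous_map_thread_eval[OF assms]]) simp
qed

text \<open>A product of finite discrete spaces is compact, and the threads form a closed subset:
  each compatibility condition is an equation between two continuous maps into a discrete
  space.\<close>

lemma compact_space_coarse_ends_at:
  assumes "\<And>B :: 'a::metric_space set. bounded B \<Longrightarrow> finite (unbounded_components \<mu> B)"
  shows "compact_space (coarse_ends_at \<mu> :: ('a set \<Rightarrow> 'a set) topology)"
proof -
  define P where "P = product_topology (\<lambda>B :: 'a set. discrete_topology (unbounded_components \<mu> B)) {B. bounded B}"
  define I where "I = {(B :: 'a set, C). bounded C \<and> B \<subseteq> C}"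
  define eqs where "eqs = (\<lambda>(B :: 'a set, C). {e \<in> topspace P. component_map \<mu> B (e C) = e B})"
  have topP: "topspace P = (\<Pi>\<^sub>E B\<in>{B. bounded B}. unbounded_components \<mu> B)"
    unfolding P_def by simp
  have "compact_space P"
    unfolding P_def compact_space_product_topology
    using assms by (simp add: compact_space_discrete_topology)
  \<comment> \<open>A nonempty index set keeps the intersection inside the product and makes it
    closed.\<close>
  have "({}, {}) \<in> I" unfolding I_def by simp
  have "coarse_threads \<mu> = (\<Inter>i\<in>I. eqs i)"
  proof (intro subset_antisym subsetI INT_I)
    fix e :: "'a set \<Rightarrow> 'a set" and i assume "e \<in> coarse_threads \<mu>" "i \<in> I"
    then show "e \<in> eqs i"
      unfolding coarse_threads_def eqs_def I_def topP by fastforce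
  next
    fix e assume e: "e \<in> (\<Inter>i\<in>I. eqs i)"
    then have "e \<in> eqs ({}, {})" using \<open>({}, {}) \<in> I\<close> by blast
    then have "e \<in> topspace P" unfolding eqs_def by simp
    moreover have "component_map \<mu> B (e C) = e B" if "bounded C" "B \<subseteq> C" for B C
    proof -
      have "(B, C) \<in> I" using that unfolding I_def by simp
      then have "e \<in> eqs (B, C)" using e by blast
      then show ?thesis unfolding eqs_def by simp
    qed
    ultimately show "e \<in> coarse_threads \<mu>" unfolding coarse_threads_def topP by simp
  qed
  moreover have "closedin P (eqs i)" if "i \<in> I" for i
  proof -
    obtain B C where i: "i = (B, C)" "bounded C" "B \<subseteq> C" using \<open>i \<in> I\<close> unfolding I_def by auto
    have "bounded B" using i bounded_subset by blast
    have proj: "continuous_map P (discrete_topology (unbounded_components \<mu> D)) (\<lambda>e. e D)"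
      if "bounded D" for D
      unfolding P_def using that by (intro continuous_map_product_projection) simp
    have "continuous_map (discrete_topology (unbounded_components \<mu> C))
        (discrete_topology (unbounded_components \<mu> B)) (component_map \<mu> B)"
      using component_map(1)[OF _ order_refl i(3)] by (auto simp: continuous_map_def)
    from continuous_map_compose[OF proj[OF i(2)] this]
    have "continuous_map P (discrete_topology (unbounded_components \<mu> B)) (\<lambda>e. component_map \<mu> B (e C))"
      by (simp add: comp_def)
    then have "closedin P {e \<in> topspace P. component_map \<mu> B (e C) = e B}"
      using proj[OF \<open>bounded B\<close>] by (intro closedin_continuous_maps_eq[OF Hausdorff_space_discrete_topology])
    then show ?thesis unfolding eqs_def i by simp
  qed
  ultimately have "closedin P (coarse_threads \<mu>)"
    using \<open>({}, {}) \<in> I\<close> by (metis (no_types) closedin_INT empty_iff)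
  then have "compactin P (coarse_threads \<mu>)"
    by (rule closedin_compact_space[OF \<open>compact_space P\<close>])
  then show ?thesis
    unfolding coarse_ends_at_def P_def[symmetric] by (rule compact_space_subtopology)
qed

text \<open>A basic open set of the product restricts finitely many coordinates. Their union is
  again bounded, and agreement at the union forces agreement at all of them.\<close>

lemma coarse_ends_at_nhd:
  assumes W: "openin (coarse_ends_at \<mu>) W" and "e \<in> W"
  obtains C where "bounded C" "\<And>e'. e' \<in> coarse_threads \<mu> \<Longrightarrow> e' C = e C \<Longrightarrow> e' \<in> W"
proof -
  define P where "P = product_topology (\<lambda>B :: 'a set. discrete_topology (unbounded_components \<mu> B)) {B. bounded B}"
  obtain T where T: "openin P T" "W = T \<inter> coarse_threads \<mu>"
    using W unfolding coarse_ends_at_def P_def[symmetric] openin_subtopology by blast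
  have "e \<in> T" "e \<in> coarse_threads \<mu>" using T(2) \<open>e \<in> W\<close> by auto
  obtain U where U: "finite {B \<in> {B. bounded B}. U B \<noteq> unbounded_components \<mu> B}"
      "e \<in> Pi\<^sub>E {B. bounded B} U" "Pi\<^sub>E {B. bounded B} U \<subseteq> T"
    using T(1) \<open>e \<in> T\<close> unfolding P_def openin_product_topology_alt by auto
  define C where "C = \<Union> {B \<in> {B. bounded B}. U B \<noteq> unbounded_components \<mu> B}"
  have bC: "bounded C" unfolding C_def using U(1) by (intro bounded_Union) auto
  have "e' \<in> W" if e': "e' \<in> coarse_threads \<mu>" "e' C = e C" for e'
  proof -
    have "e' \<in> Pi\<^sub>E {B. bounded B} U"
    proof (rule PiE_I)
      fix B :: "'a set" assume B: "B \<in> {B. bounded B}"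
      show "e' B \<in> U B"
      proof (cases "U B = unbounded_components \<mu> B")
        case True
        then show ?thesis using coarse_threadsD[OF e'(1)] B by simp
      next
        case False
        then have "B \<subseteq> C" using B unfolding C_def by blast
        then have "e' B = e B"
          using coarse_threads_eq_mono[OF e'(1) \<open>e \<in> coarse_threads \<mu>\<close> bC _ e'(2)] by simp
        then show ?thesis using U(2) B by auto
      qed
    next
      fix B :: "'a set" assume "B \<notin> {B. bounded B}"
      then show "e' B = undefined"
        using e'(1) unfolding coarse_threads_iff by (auto simp: extensional_def)
    qed
    then show ?thesis using U(3) e'(1) T(2) by blast
  qed
  with bC show ?thesis by (rule that)
qed


section \<open>Stability of the ends\<close>

text \<open>\<open>component_map_eqI\<close> requires the jump size not to decrease from
  \<open>U\<close> to \<open>V\<close>; passing from \<open>\<nu>\<close> back to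
  \<open>\<mu>\<close> may decrease it.\<close>

lemma component_map_containing:
  assumes "V \<in> unbounded_components \<mu> B" "U \<subseteq> V" "U \<noteq> {}"
  shows "component_map \<mu> B U = V"
  unfolding component_map_def
proof (rule the_equality)
  fix W assume W: "W \<in> unbounded_components \<mu> B \<and> U \<subseteq> W"
  obtain u where "u \<in> U" using assms(3) by blast
  then show "W = V"
    using W assms(2) by (intro component_inter[OF conjunct1[OF W] assms(1), of u]) auto
qed (use assms in simp)

lemma ends_map_superset:
  assumes "e \<in> coarse_threads \<mu>" "\<mu> \<le> \<nu>" "bounded B"
  shows "e B \<subseteq> ends_map \<nu> e B"
  unfolding ends_map_def
  using component_map(2)[OF coarse_threadsD[OF assms(1,3)] assms(2) order_refl] assms(3) by simp

context coarse_geometry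
begin

text \<open>Quasi-convexity makes every \<open>\<E>\<^bsub>\<nu>\<^esub>\<close> map to \<open>\<E>\<^bsub>\<mu>\<^esub>\<close>, even for \<open>\<nu> > \<mu>\<close>, where this inverts
  \<open>\<theta>\<^bsub>\<mu>,\<nu>\<^esub>\<close>.\<close>

definition settle :: "real \<Rightarrow> ('a set \<Rightarrow> 'a set) \<Rightarrow> 'a set \<Rightarrow> 'a set" where
  "settle \<nu> e = (\<lambda>B\<in>{B. bounded B}. component_map \<mu> B (e (thicken B (a * \<nu> + b))))"

text \<open>By \<open>coarse_rel_shrink\<close>, a \<open>\<nu>\<close>-component outside the
  thickening of \<open>B\<close> lies in a single \<open>\<mu>\<close>-component outside
  \<open>B\<close>.\<close>

lemma settle:
  assumes e: "e \<in> coarse_threads \<nu>" and "0 < \<nu>" and B: "bounded B"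
  shows "settle \<nu> e B \<in> unbounded_components \<mu> B" "e (thicken B (a * \<nu> + b)) \<subseteq> settle \<nu> e B"
proof -
  define D where "D = thicken B (a * \<nu> + b)"
  have "bounded D" unfolding D_def using bounded_thicken B by blast
  note U = coarse_threadsD[OF e this]
  obtain u where u: "u \<in> e D" using unbounded_componentD(2)[OF U] by blast
  have sub: "e D \<subseteq> coarse_rel \<mu> (- B) `` {u}"
  proof
    fix v assume "v \<in> e D"
    then have "(u, v) \<in> coarse_rel \<nu> (- D)" using component_rel[OF U u] by simp
    then have "(u, v) \<in> coarse_rel \<mu> (- B)"
      by (rule coarse_rel_shrink) (use \<open>0 < \<nu>\<close> in \<open>auto simp: D_def\<close>)
    then show "v \<in> coarse_rel \<mu> (- B) `` {u}" by simp
  qed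
  have V: "coarse_rel \<mu> (- B) `` {u} \<in> unbounded_components \<mu> B"
  proof (rule unbounded_componentI)
    show "u \<notin> B" using sub u coarse_rel_in by blast
    show "\<not> bounded (coarse_rel \<mu> (- B) `` {u})"
      using bounded_subset[OF _ sub] unbounded_componentD(1)[OF U] by blast
  qed
  have "settle \<nu> e B = coarse_rel \<mu> (- B) `` {u}"
    unfolding settle_def
    using component_map_containing[OF V sub unbounded_componentD(2)[OF U]] B by (simp add: D_def)
  then show "settle \<nu> e B \<in> unbounded_components \<mu> B" "e (thicken B (a * \<nu> + b)) \<subseteq> settle \<nu> e B"
    using V sub by (simp_all add: D_def)
qed

text \<open>The freedom to take a larger \<open>t\<close> allows comparisons between scales whose
  thickenings differ.\<close>

lemma settle_eqI:
  assumes e: "e \<in> coarse_threads \<nu>" "0 < \<nu>" "bounded B"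
    and V: "V \<in> unbounded_components \<mu> B" and t: "a * \<nu> + b \<le> t" "e (thicken B t) \<subseteq> V"
  shows "settle \<nu> e B = V"
proof -
  have bt: "bounded (thicken B t)" using e(3) by (rule bounded_thicken)
  obtain u where u: "u \<in> e (thicken B t)"
    using unbounded_componentD(2)[OF coarse_threadsD[OF e(1) bt]] by blast
  have "e (thicken B t) \<subseteq> e (thicken B (a * \<nu> + b))"
    using coarse_threads_mono[OF e(1) bt thicken_mono[OF order_refl t(1)]] .
  then have "u \<in> settle \<nu> e B" using settle(2)[OF e] u by blast
  then show ?thesis using t(2) u by (intro component_inter[OF settle(1)[OF e] V, of u]) auto
qed

lemma settle_in:
  assumes e: "e \<in> coarse_threads \<nu>" and "0 < \<nu>"
  shows "settle \<nu> e \<in> coarse_threads \<mu>"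
  unfolding coarse_threads_iff
proof (intro conjI allI impI)
  show "settle \<nu> e \<in> extensional {B. bounded B}" unfolding settle_def by simp
  show "settle \<nu> e B \<in> unbounded_components \<mu> B" if "bounded B" for B
    by (rule settle(1)[OF assms that])
  fix B C :: "'a set" assume C: "bounded C" "B \<subseteq> C"
  have B: "bounded B" using bounded_subset[OF C] .
  have bt: "bounded (thicken C (a * \<nu> + b))" using C(1) by (rule bounded_thicken)
  obtain u where u: "u \<in> e (thicken C (a * \<nu> + b))"
    using unbounded_componentD(2)[OF coarse_threadsD[OF e bt]] by blast
  have "e (thicken C (a * \<nu> + b)) \<subseteq> e (thicken B (a * \<nu> + b))"
    using coarse_threads_mono[OF e bt thicken_mono[OF C(2) order_refl]] .
  then have "u \<in> settle \<nu> e B" "u \<in> settle \<nu> e C"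
    using settle(2)[OF assms B] settle(2)[OF assms C(1)] u by blast+
  then show "settle \<nu> e C \<subseteq> settle \<nu> e B"
    using C(2) by (intro component_subset[OF settle(1)[OF assms C(1)] settle(1)[OF assms B], of u]) auto
qed

lemma settle_self:
  assumes "e \<in> coarse_threads \<mu>"
  shows "settle \<mu> e = e"
proof (rule coarse_threads_eqI[OF settle_in[OF assms mu_pos] assms])
  fix B :: "'a set" assume B: "bounded B"
  have "0 \<le> a * \<mu> + b" using a_nonneg b_nonneg mu_pos by simp
  then have "e (thicken B (a * \<mu> + b)) \<subseteq> e B"
    by (intro coarse_threads_mono[OF assms bounded_thicken[OF B] thicken_superset])
  then show "settle \<mu> e B = e B"
    by (intro settle_eqI[OF assms mu_pos B coarse_threadsD[OF assms B] order_refl])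
qed

text \<open>Both sides at \<open>B\<close> contain the value of \<open>e\<close> at the thickening
  for \<open>\<kappa>\<close>. This makes \<open>settle\<close> constant on the classes of
  \<open>ends_rel\<close>.\<close>

lemma settle_ends_map:
  assumes e: "e \<in> coarse_threads \<nu>" and "0 < \<nu>" "\<nu> \<le> \<kappa>"
  shows "settle \<kappa> (ends_map \<kappa> e) = settle \<nu> e"
proof -
  have \<kappa>: "0 < \<kappa>" using assms by simp
  note E = ends_map_in[OF e \<open>\<nu> \<le> \<kappa>\<close>]
  have "settle \<nu> e B = settle \<kappa> (ends_map \<kappa> e) B" if B: "bounded B" for B
  proof (rule settle_eqI[OF e assms(2) B settle(1)[OF E \<kappa> B]])
    show "a * \<nu> + b \<le> a * \<kappa> + b" using a_nonneg assms(3) by (simp add: mult_left_mono)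
    show "e (thicken B (a * \<kappa> + b)) \<subseteq> settle \<kappa> (ends_map \<kappa> e) B"
      using ends_map_superset[OF e assms(3) bounded_thicken[OF B]] settle(2)[OF E \<kappa> B]
      by (rule order_trans)
  qed
  then show ?thesis
    by (intro coarse_threads_eqI[OF settle_in[OF E \<kappa>] settle_in[OF e assms(2)]]) simp
qed

lemma ends_rel_settle:
  assumes e: "e \<in> coarse_threads \<nu>" and "0 < \<nu>"
  shows "((\<nu>, e), (\<mu>, settle \<nu> e)) \<in> ends_rel"
proof -
  define \<kappa> where "\<kappa> = max \<nu> \<mu>"
  have \<kappa>: "\<nu> \<le> \<kappa>" "\<mu> \<le> \<kappa>" unfolding \<kappa>_def by auto
  note S = settle_in[OF assms]
  have "ends_map \<kappa> e = ends_map \<kappa> (settle \<nu> e)"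
  proof (rule coarse_threads_eqI[OF ends_map_in[OF e \<kappa>(1)] ends_map_in[OF S \<kappa>(2)]])
    fix B :: "'a set" assume B: "bounded B"
    have t: "0 \<le> a * \<nu> + b" using a_nonneg b_nonneg assms(2) by simp
    have bt: "bounded (thicken B (a * \<nu> + b))" using B by (rule bounded_thicken)
    obtain u where u: "u \<in> e (thicken B (a * \<nu> + b))"
      using unbounded_componentD(2)[OF coarse_threadsD[OF e bt]] by blast
    have "u \<in> e B" using coarse_threads_mono[OF e bt thicken_superset[OF t]] u by blast
    then have "u \<in> ends_map \<kappa> e B" using ends_map_superset[OF e \<kappa>(1) B] by blast
    moreover have "u \<in> ends_map \<kappa> (settle \<nu> e) B"
      using ends_map_superset[OF S \<kappa>(2) B] settle(2)[OF assms B] u by blast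
    ultimately show "ends_map \<kappa> e B = ends_map \<kappa> (settle \<nu> e) B"
      by (rule component_inter[OF coarse_threadsD[OF ends_map_in[OF e \<kappa>(1)] B]
            coarse_threadsD[OF ends_map_in[OF S \<kappa>(2)] B]])
  qed
  then show ?thesis
    unfolding ends_rel_def using assms S mu_pos \<kappa> by auto
qed

lemma settle_eq_if_ends_rel:
  assumes "((\<nu>, e), (\<nu>', e')) \<in> ends_rel"
  shows "settle \<nu> e = settle \<nu>' e'"
proof -
  obtain \<kappa> where \<kappa>: "0 < \<nu>" "0 < \<nu>'" "e \<in> coarse_threads \<nu>" "e' \<in> coarse_threads \<nu>'"
    "\<nu> \<le> \<kappa>" "\<nu>' \<le> \<kappa>" "ends_map \<kappa> e = ends_map \<kappa> e'"
    using assms unfolding ends_rel_def by auto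
  show ?thesis
    using settle_ends_map[OF \<kappa>(3,1,5)] settle_ends_map[OF \<kappa>(4,2,6)] \<kappa>(7) by simp
qed

text \<open>The coordinate of \<open>settle \<nu> e\<close> at \<open>B\<close> depends only on the
  coordinate of \<open>e\<close> at the thickening of \<open>B\<close>.\<close>

lemma continuous_map_settle:
  assumes "0 < \<nu>"
  shows "continuous_map (coarse_ends_at \<nu>) (coarse_ends_at \<mu>) (settle \<nu>)"
  unfolding coarse_ends_at_def[of \<mu>] continuous_map_in_subtopology continuous_map_componentwise
proof (intro conjI ballI)
  show "settle \<nu> ` topspace (coarse_ends_at \<nu>) \<subseteq> extensional {B. bounded B}"
    unfolding settle_def by auto
  show "settle \<nu> \<in> topspace (coarse_ends_at \<nu>) \<rightarrow> coarse_threads \<mu>"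
    using settle_in assms by simp
  fix B :: "'a set" assume "B \<in> {B. bounded B}"
  then have B: "bounded B" by simp
  show "continuous_map (coarse_ends_at \<nu>) (discrete_topology (unbounded_components \<mu> B)) (\<lambda>e. settle \<nu> e B)"
    unfolding continuous_map_def
  proof (intro conjI allI impI)
    show "(\<lambda>e. settle \<nu> e B) \<in> topspace (coarse_ends_at \<nu>) \<rightarrow> topspace (discrete_topology (unbounded_components \<mu> B))"
      using settle(1) assms B by simp
    fix F
    have eq: "{e \<in> topspace (coarse_ends_at \<nu>). settle \<nu> e B \<in> F} =
        {e \<in> coarse_threads \<nu>. e (thicken B (a * \<nu> + b)) \<in> component_map \<mu> B -` F}"
      unfolding settle_def using B by simp
    show "openin (coarse_ends_at \<nu>) {e \<in> topspace (coarse_ends_at \<nu>). settle \<nu> e B \<in> F}"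
      unfolding eq by (rule clopen_thread_eval(1)[OF bounded_thicken[OF B]])
  qed
qed

text \<open>The maps \<open>settle \<nu>\<close> together descend to the quotient as
  \<open>g\<close>; the inverse \<open>h\<close> is the inclusion of the summand at scale
  \<open>\<mu>\<close> followed by the quotient map. \<open>settle_self\<close> and
  \<open>ends_rel_settle\<close> give the two compositions.\<close>

theorem coarse_ends_homeomorphic:
  "(coarse_ends :: (real \<times> ('a set \<Rightarrow> 'a set)) set topology) homeomorphic_space
     (coarse_ends_at \<mu> :: ('a set \<Rightarrow> 'a set) topology)"
proof -
  define S where "S = sum_topology (coarse_ends_at :: _ \<Rightarrow> ('a set \<Rightarrow> 'a set) topology) {0<..}"
  define q where "q = (\<lambda>x :: real \<times> ('a set \<Rightarrow> 'a set). ends_rel `` {x})"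
  define \<psi> where "\<psi> = (\<lambda>(\<nu>, e). settle \<nu> e)"
  have topS: "(\<nu>, e) \<in> topspace S \<longleftrightarrow> 0 < \<nu> \<and> e \<in> coarse_threads \<nu>" for \<nu> e
    unfolding S_def by simp
  have q: "quotient_map S coarse_ends q"
    unfolding coarse_ends_def S_def q_def by (rule quotient_map_quotient_topology)
  have q_eq: "q x = q y \<longleftrightarrow> (x, y) \<in> ends_rel" if "x \<in> topspace S" "y \<in> topspace S" for x y
    unfolding q_def using that eq_equiv_class_iff[OF equiv_ends_rel] unfolding S_def by metis
  have "continuous_map S (coarse_ends_at \<mu>) \<psi>"
    unfolding continuous_map_def
  proof (intro conjI allI impI)
    show "\<psi> \<in> topspace S \<rightarrow> topspace (coarse_ends_at \<mu>)"
      using settle_in by (auto simp: \<psi>_def topS)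
    fix W :: "('a set \<Rightarrow> 'a set) set" assume W: "openin (coarse_ends_at \<mu>) W"
    show "openin S {x \<in> topspace S. \<psi> x \<in> W}"
      unfolding S_def openin_sum_topology
    proof (intro conjI ballI)
      fix \<nu> :: real assume "\<nu> \<in> {0<..}"
      then have "{e. (\<nu>, e) \<in> {x \<in> topspace S. \<psi> x \<in> W}} = {e \<in> topspace (coarse_ends_at \<nu>). settle \<nu> e \<in> W}"
        by (simp add: \<psi>_def topS)
      then show "openin (coarse_ends_at \<nu>) {e. (\<nu>, e) \<in> {x \<in> topspace (sum_topology coarse_ends_at {0<..}). \<psi> x \<in> W}}"
        using openin_continuous_map_preimage[OF continuous_map_settle W, of \<nu>] \<open>\<nu> \<in> {0<..}\<close>
        unfolding S_def by simp
    qed auto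
  qed
  moreover have "\<psi> x = \<psi> y" if "x \<in> topspace S" "y \<in> topspace S" "q x = q y" for x y
  proof -
    have "(x, y) \<in> ends_rel" using q_eq that by simp
    then show ?thesis unfolding \<psi>_def by (cases x, cases y) (simp add: settle_eq_if_ends_rel)
  qed
  ultimately obtain g where g: "continuous_map coarse_ends (coarse_ends_at \<mu>) g"
    "\<And>x. x \<in> topspace S \<Longrightarrow> g (q x) = \<psi> x"
    using quotient_map_lift_exists[OF q] by metis
  define h where "h = (\<lambda>e. q (\<mu>, e))"
  have "continuous_map (coarse_ends_at \<mu>) S (\<lambda>e. (\<mu>, e))"
    unfolding S_def by (rule continuous_map_component_injection) (use mu_pos in simp)
  from continuous_map_compose[OF this quotient_imp_continuous_map[OF q]]
  have h: "continuous_map (coarse_ends_at \<mu>) coarse_ends h" unfolding h_def comp_def .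
  have gh: "g (h e) = e" if "e \<in> coarse_threads \<mu>" for e
    unfolding h_def using g(2)[of "(\<mu>, e)"] that mu_pos by (simp add: topS \<psi>_def settle_self)
  have hg: "h (g w) = w" if w: "w \<in> topspace coarse_ends" for w
  proof -
    obtain x where x: "x \<in> topspace S" "w = q x"
      using w quotient_imp_surjective_map[OF q] by blast
    obtain \<nu> e where xe: "x = (\<nu>, e)" by (cases x)
    have \<nu>: "0 < \<nu>" "e \<in> coarse_threads \<nu>" using x xe topS by auto
    have "h (g w) = q (\<mu>, settle \<nu> e)"
      unfolding h_def using g(2)[OF x(1)] x(2) xe by (simp add: \<psi>_def)
    also have "\<dots> = q x"
      using q_eq[OF x(1), of "(\<mu>, settle \<nu> e)"] ends_rel_settle[OF \<nu>(2,1)] settle_in[OF \<nu>(2,1)] mu_pos xe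
      by (simp add: topS)
    finally show ?thesis using x(2) by simp
  qed
  have "homeomorphic_maps coarse_ends (coarse_ends_at \<mu>) g h"
    unfolding homeomorphic_maps_def using g(1) h gh hg by simp
  then show ?thesis unfolding homeomorphic_space_def by blast
qed

end


section \<open>Perfectness\<close>

locale coarse_symmetric_geometry = coarse_geometry \<Gamma> R a b \<mu>
  for \<Gamma> :: "'a::metric_space set" and R a b \<mu> +
  fixes K L :: real
  assumes K_nonneg: "0 \<le> K" and K_le: "K \<le> \<mu>" and L_ge_1: "1 \<le> L"
    and quasi_symmetric: "\<exists>(A :: 'a set) (A' :: 'a set) f. x \<in> A \<and> y \<in> A' \<and> metric_net K A \<and> metric_net K A' \<and>
          bij_betw f A A' \<and> f x = y \<and>
          (\<forall>u\<in>A. \<forall>v\<in>A. 1 / L * dist u v \<le> dist (f u) (f v) \<and> dist (f u) (f v) \<le> L * dist u v)"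
begin

text \<open>A bi-Lipschitz map between nets taking \<open>x0\<close> to \<open>y\<close> is inverted coarsely by a map \<open>k\<close> that
  sends components outside a ball around \<open>y\<close> into components outside a ball around \<open>x0\<close>.\<close>

lemma transport_components:
  fixes x0 :: 'a
  assumes "0 \<le> r"
  obtains r' where "0 \<le> r'"
    "\<forall>y :: 'a. \<exists>g. inj_on g (unbounded_components \<mu> (cball x0 r)) \<and>
        g ` unbounded_components \<mu> (cball x0 r) \<subseteq> unbounded_components \<mu> (cball y r')"
proof -
  \<comment> \<open>\<open>\<nu>\<close> bounds the image under \<open>k\<close> of a
    \<open>\<mu>\<close>-jump: \<open>K\<close> is lost at each end and \<open>L\<close> is the
    Lipschitz factor. \<open>s\<close> adds to \<open>r\<close> the margin for turning
    \<open>\<nu>\<close>-chains into \<open>\<mu>\<close>-chains, and \<open>r'\<close> is chosen so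
    that \<open>k\<close> maps points outside \<open>cball y r'\<close> to points outside
    \<open>cball x0 s\<close>. None of them depends on \<open>y\<close>.\<close>
  define \<nu> where "\<nu> = L * (\<mu> + 2 * K)"
  define s where "s = r + (a * \<nu> + b)"
  define r' where "r' = K + L * s"
  have L: "0 < L" using L_ge_1 by simp
  have \<nu>: "0 \<le> \<nu>" unfolding \<nu>_def using L K_nonneg mu_pos by simp
  have s: "0 \<le> s" unfolding s_def using \<nu> assms a_nonneg b_nonneg by simp
  have r': "0 \<le> r'" unfolding r'_def using s L K_nonneg by simp
  have "\<exists>g. inj_on g (unbounded_components \<mu> (cball x0 r)) \<and>
        g ` unbounded_components \<mu> (cball x0 r) \<subseteq> unbounded_components \<mu> (cball y r')" for y :: 'a
  proof -
    obtain A A' :: "'a set" and f where f: "x0 \<in> A" "y \<in> A'" "metric_net K A" "metric_net K A'"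
      "bij_betw f A A'" "f x0 = y"
      and "\<forall>u\<in>A. \<forall>v\<in>A. 1 / L * dist u v \<le> dist (f u) (f v) \<and> dist (f u) (f v) \<le> L * dist u v"
      using quasi_symmetric[of x0 y] by blast
    then have lip: "dist u v \<le> L * dist (f u) (f v)" "dist (f u) (f v) \<le> L * dist u v"
      if "u \<in> A" "v \<in> A" for u v
      using that L by (auto simp: field_simps)
    \<comment> \<open>Exactness on \<open>A'\<close> is demanded so that \<open>k\<close> inverts
      \<open>f\<close> on \<open>A\<close>, which later puts \<open>k v\<close> into the prescribed
      component.\<close>
    have "\<exists>u\<in>A. dist z (f u) \<le> K \<and> (z \<in> A' \<longrightarrow> f u = z)" for z
    proof (cases "z \<in> A'")
      case True
      then obtain u where "u \<in> A" "f u = z" using f(5) unfolding bij_betw_def by blast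
      then show ?thesis using K_nonneg by (intro bexI[of _ u]) auto
    next
      case False
      obtain w where "w \<in> A'" "dist z w \<le> K" using f(4) unfolding metric_net_def by blast
      moreover then obtain u where "u \<in> A" "f u = w" using f(5) unfolding bij_betw_def by blast
      ultimately show ?thesis using False by blast
    qed
    then obtain k where k: "\<And>z. k z \<in> A" "\<And>z. dist z (f (k z)) \<le> K" "\<And>z. z \<in> A' \<Longrightarrow> f (k z) = z"
      by metis
    have kf: "k (f u) = u" if "u \<in> A" for u
      using k(1)[of "f u"] k(3)[of "f u"] f(5) that unfolding bij_betw_def inj_on_def by blast
    have k_step: "dist (k u) (k v) \<le> \<nu>" if "dist u v \<le> \<mu>" for u v
    proof -
      have "dist (f (k u)) (f (k v)) \<le> \<mu> + 2 * K"
        using that k(2)[of u] k(2)[of v] dist_triangle[of "f (k u)" "f (k v)" u]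
          dist_triangle[of u "f (k v)" v] by (simp add: dist_commute)
      then have "L * dist (f (k u)) (f (k v)) \<le> \<nu>" unfolding \<nu>_def using L by simp
      then show ?thesis using lip(1)[OF k(1) k(1), of u v] by simp
    qed
    have k_far: "k z \<in> - cball x0 s" if "z \<in> - cball y r'" for z
    proof -
      have "r' < dist y z" using that by auto
      also have "\<dots> \<le> dist (f x0) (f (k z)) + K"
        using k(2)[of z] dist_triangle[of y z "f (k z)"] f(6) by (simp add: dist_commute)
      also have "\<dots> \<le> L * dist x0 (k z) + K" using lip(2)[OF f(1) k(1), of z] by simp
      finally have "L * s < L * dist x0 (k z)" unfolding r'_def by simp
      then show ?thesis using L by simp
    qed
    have k_rel: "(k u, k v) \<in> coarse_rel \<mu> (- cball x0 r)"
      if "(u, v) \<in> coarse_rel \<mu> (- cball y r')" for u v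
    proof -
      have "(k u, k v) \<in> coarse_rel \<nu> (- cball x0 s)"
        using that by (rule coarse_rel_map) (intro coarse_rel_edge k_far k_step; assumption)+
      then show ?thesis
        by (rule coarse_rel_shrink) (use thicken_cball \<nu> in \<open>auto simp: s_def\<close>)
    qed
    have "\<exists>V. V \<in> unbounded_components \<mu> (cball y r') \<and> (\<exists>v\<in>V. k v \<in> W)"
      if W: "W \<in> unbounded_components \<mu> (cball x0 r)" for W
    proof -
      \<comment> \<open>A net point near a far point of \<open>W\<close> is one
        \<open>\<mu>\<close>-jump away, as \<open>K \<le> \<mu>\<close>, and still outside the ball,
        so it lies in \<open>W\<close>. Thus \<open>A \<inter> W\<close> is unbounded, and
        \<open>f\<close> shrinks distances at most by the factor \<open>L\<close>.\<close>
      have "\<not> bounded (f ` (A \<inter> W))"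
      proof
        assume "bounded (f ` (A \<inter> W))"
        then obtain m where m: "\<And>u. u \<in> A \<Longrightarrow> u \<in> W \<Longrightarrow> dist y (f u) \<le> m"
          unfolding bounded_any_center[of _ y] by blast
        obtain w where w: "w \<in> W" "max r (L * m) + K < dist x0 w"
          using unbounded_far[OF unbounded_componentD(1)[OF W]] by blast
        obtain u where u: "u \<in> A" "dist w u \<le> K" using f(3) unfolding metric_net_def by blast
        have du: "max r (L * m) < dist x0 u"
          using w(2) u(2) dist_triangle[of x0 w u] dist_commute[of u w] by linarith
        have "w \<notin> cball x0 r" using unbounded_componentD(3)[OF W] w(1) by blast
        then have "(w, u) \<in> coarse_rel \<mu> (- cball x0 r)"
          using du u(2) K_le by (intro coarse_rel_edge) auto
        then have "u \<in> W" using component_rel[OF W w(1)] by simp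
        then have "dist x0 u \<le> L * m"
          using lip(1)[OF f(1) u(1)] m[OF u(1)] f(6) L by (smt (verit) mult_left_mono)
        then show False using du by simp
      qed
      then obtain V where V: "V \<in> unbounded_components \<mu> (cball y r')" "\<not> bounded (V \<inter> f ` (A \<inter> W))"
        by (rule unbounded_component_meets[OF _ bounded_cball])
      then have "V \<inter> f ` (A \<inter> W) \<noteq> {}" by (metis bounded_empty)
      then obtain u where "u \<in> A" "u \<in> W" "f u \<in> V" by blast
      then show ?thesis using V(1) kf by (intro exI[of _ V] conjI bexI[of _ "f u"]) auto
    qed
    then obtain g where g: "\<And>W. W \<in> unbounded_components \<mu> (cball x0 r) \<Longrightarrow>
        g W \<in> unbounded_components \<mu> (cball y r') \<and> (\<exists>v\<in>g W. k v \<in> W)"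
      by metis
    \<comment> \<open>\<open>k\<close> sends the common component \<open>g W = g W'\<close> into one
      component outside \<open>cball x0 r\<close>, and it meets both \<open>W\<close> and
      \<open>W'\<close>.\<close>
    have "inj_on g (unbounded_components \<mu> (cball x0 r))"
    proof (rule inj_onI)
      fix W W' assume W: "W \<in> unbounded_components \<mu> (cball x0 r)" "W' \<in> unbounded_components \<mu> (cball x0 r)"
        and eq: "g W = g W'"
      obtain v where v: "v \<in> g W" "k v \<in> W" using g[OF W(1)] by blast
      obtain v' where v': "v' \<in> g W" "k v' \<in> W'" using g[OF W(2)] eq by auto
      have "(v, v') \<in> coarse_rel \<mu> (- cball y r')" using component_rel v(1) v'(1) g[OF W(1)] by blast
      then have "k v' \<in> W" using component_rel[OF W(1) v(2)] k_rel by simp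
      then show "W = W'" using v'(2) by (rule component_inter[OF W])
    qed
    then show ?thesis using g by blast
  qed
  then have "\<forall>y :: 'a. \<exists>g. inj_on g (unbounded_components \<mu> (cball x0 r)) \<and>
        g ` unbounded_components \<mu> (cball x0 r) \<subseteq> unbounded_components \<mu> (cball y r')" ..
  with r' show ?thesis by (rule that)
qed

lemma three_components:
  fixes x0 :: 'a and e1 e2 e3 :: "'a set \<Rightarrow> 'a set"
  assumes e: "e1 \<in> coarse_threads \<mu>" "e2 \<in> coarse_threads \<mu>" "e3 \<in> coarse_threads \<mu>"
    and ne: "e1 \<noteq> e2" "e1 \<noteq> e3" "e2 \<noteq> e3"
  obtains r where "0 \<le> r" "card (unbounded_components \<mu> (cball x0 r)) \<ge> 3"
proof -
  have ex: "\<exists>B. bounded B \<and> e B \<noteq> e' B"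
    if "e \<in> coarse_threads \<mu>" "e' \<in> coarse_threads \<mu>" "e \<noteq> e'" for e e' :: "'a set \<Rightarrow> 'a set"
  proof (rule ccontr)
    assume "\<nexists>B. bounded B \<and> e B \<noteq> e' B"
    then have "e = e'" by (intro coarse_threads_eqI[OF that(1,2)]) simp
    with that(3) show False ..
  qed
  obtain B1 where B1: "bounded B1" "e1 B1 \<noteq> e2 B1" using ex[OF e(1,2) ne(1)] by (elim exE conjE)
  obtain B2 where B2: "bounded B2" "e1 B2 \<noteq> e3 B2" using ex[OF e(1,3) ne(2)] by (elim exE conjE)
  obtain B3 where B3: "bounded B3" "e2 B3 \<noteq> e3 B3" using ex[OF e(2,3) ne(3)] by (elim exE conjE)
  note B = B1 B2 B3
  have "bounded (B1 \<union> B2 \<union> B3)" using B by simp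
  then obtain n :: nat where n: "B1 \<union> B2 \<union> B3 \<subseteq> cball x0 (real n)" using bounded_in_cball by blast
  define C where "C = cball x0 (real n)"
  have C: "bounded C" "B1 \<subseteq> C" "B2 \<subseteq> C" "B3 \<subseteq> C" using n unfolding C_def by auto
  have "e1 C \<noteq> e2 C" "e1 C \<noteq> e3 C" "e2 C \<noteq> e3 C"
    using coarse_threads_eq_mono[OF e(1,2) C(1,2)] coarse_threads_eq_mono[OF e(1,3) C(1,3)]
      coarse_threads_eq_mono[OF e(2,3) C(1,4)] B(2,4,6) by argo+
  then have "card {e1 C, e2 C, e3 C} = 3" by simp
  moreover have "{e1 C, e2 C, e3 C} \<subseteq> unbounded_components \<mu> C"
    using coarse_threadsD[OF _ C(1)] e by simp
  ultimately have "3 \<le> card (unbounded_components \<mu> C)"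
    using card_mono[OF finite_unbounded_components[OF C(1)], of "{e1 C, e2 C, e3 C}"] by linarith
  then show ?thesis unfolding C_def by (intro that[of "real n"]) auto
qed

text \<open>Far out in the component \<open>U\<close> of the given end there is, by quasi-symmetry, a ball whose
  complement has three unbounded components. Only one of them can meet the complement of \<open>U\<close>, so \<open>U\<close>
  contains two ends.\<close>

lemma other_end:
  fixes x0 :: 'a and B :: "'a set"
  assumes r: "0 \<le> r" "card (unbounded_components \<mu> (cball x0 r)) \<ge> 3"
    and e: "e \<in> coarse_threads \<mu>" and B: "bounded B"
  obtains e' where "e' \<in> coarse_threads \<mu>" "e' \<noteq> e" "e' B = e B"
proof -
  obtain r' where r': "0 \<le> r'" "\<forall>y :: 'a. \<exists>g. inj_on g (unbounded_components \<mu> (cball x0 r)) \<and>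
        g ` unbounded_components \<mu> (cball x0 r) \<subseteq> unbounded_components \<mu> (cball y r')"
    using transport_components[OF r(1), of x0] .
  obtain n :: nat where n: "B \<subseteq> cball x0 (real n)" using bounded_in_cball[OF B] by blast
  define C where "C = cball x0 (real n)"
  have bC: "bounded C" unfolding C_def by simp
  have "x0 \<in> C" unfolding C_def by simp
  define U where "U = e C"
  have U: "U \<in> unbounded_components \<mu> C" unfolding U_def by (rule coarse_threadsD[OF e bC])
  define n' where "n' = real n + (a * real n + b)"
  \<comment> \<open>The first term keeps chains from \<open>y\<close> to points of
    \<open>cball y r'\<close> out of \<open>C\<close>; the second keeps chains from points of
    \<open>C\<close> to \<open>x0\<close>, which stay within \<open>n'\<close> of \<open>x0\<close>,
    out of \<open>cball y r'\<close>.\<close>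
  define \<rho> where "\<rho> = max (real n + (a * r' + b)) (n' + r')"
  obtain y where y: "y \<in> U" "\<rho> < dist x0 y"
    using unbounded_far[OF unbounded_componentD(1)[OF U]] by blast
  have ball_sub: "cball y r' \<subseteq> U"
  proof
    fix w assume "w \<in> cball y r'"
    then have w: "dist y w \<le> r'" by simp
    have "cball y (a * dist y w + b) \<subseteq> - C"
    proof
      fix v assume "v \<in> cball y (a * dist y w + b)"
      then have "dist y v \<le> a * dist y w + b" by simp
      also have "\<dots> \<le> a * r' + b" using w a_nonneg by (simp add: mult_left_mono)
      finally have "real n < dist x0 v"
        using y(2) dist_triangle[of x0 y v] unfolding \<rho>_def by (simp add: dist_commute)
      then show "v \<in> - C" unfolding C_def by simp
    qed
    then have "(y, w) \<in> coarse_rel \<mu> (- C)" by (rule coarse_rel_subset[OF chain order_refl])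
    then show "w \<in> U" using component_rel[OF U y(1)] by simp
  qed
  have C_rel: "(w, x0) \<in> coarse_rel \<mu> (- cball y r')" if "w \<in> C" for w
  proof -
    have dw: "dist w x0 \<le> real n" using that unfolding C_def by (simp add: dist_commute)
    have "cball w (a * dist w x0 + b) \<subseteq> - cball y r'"
    proof
      fix v assume "v \<in> cball w (a * dist w x0 + b)"
      then have "dist w v \<le> a * dist w x0 + b" by simp
      also have "\<dots> \<le> a * real n + b" using dw a_nonneg by (simp add: mult_left_mono)
      finally have "dist x0 v \<le> n'"
        using dw dist_triangle[of x0 v w] unfolding n'_def by (simp add: dist_commute)
      then have "r' < dist y v"
        using y(2) dist_triangle[of x0 y v] unfolding \<rho>_def by (simp add: dist_commute)
      then show "v \<in> - cball y r'" by simp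
    qed
    then show ?thesis by (rule coarse_rel_subset[OF chain order_refl])
  qed
  \<comment> \<open>A chain from \<open>z\<close> towards \<open>C\<close> cannot enter the
    component \<open>U\<close> and so avoids the ball inside \<open>U\<close>; once in
    \<open>C\<close>, \<open>C_rel\<close> completes it to \<open>x0\<close>.\<close>
  have outside_rel: "(z, x0) \<in> coarse_rel \<mu> (- cball y r')" if "z \<notin> U" for z
  proof (cases "z \<in> C")
    case False
    obtain u v where u: "(z, u) \<in> coarse_rel \<mu> (- C)" "v \<in> C" "dist u v \<le> \<mu>"
      by (rule coarse_rel_exit[OF coarsely_connected[of z x0] False \<open>x0 \<in> C\<close>])
    have avoid: "w \<in> - cball y r'" if "(z, w) \<in> coarse_rel \<mu> (- C)" for w
    proof -
      have "w \<notin> U"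
        using component_rel[OF U, of w z] coarse_rel_sym[OF that] \<open>z \<notin> U\<close> by blast
      then show ?thesis using ball_sub by blast
    qed
    have "z \<in> - C" using False by simp
    have "(z, u) \<in> coarse_rel \<mu> (- cball y r')"
      using u(1)
    proof (induction rule: coarse_rel_induct)
      case base
      then show ?case using avoid[OF coarse_rel_refl[OF \<open>z \<in> - C\<close>]] by (rule coarse_rel_refl)
    next
      case (step v w)
      have "(z, w) \<in> coarse_rel \<mu> (- C)"
        using step(1) coarse_rel_edge[OF step(2,3,4)] by (rule coarse_rel_trans)
      then have "(v, w) \<in> coarse_rel \<mu> (- cball y r')"
        using avoid[OF step(1)] avoid step(4) by (intro coarse_rel_edge)
      with step(5) show ?case by (rule coarse_rel_trans)
    qed
    moreover have "(u, v) \<in> coarse_rel \<mu> (- cball y r')"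
      using avoid[OF u(1)] coarse_rel_in[OF C_rel[OF u(2)]] u(3) by (intro coarse_rel_edge) auto
    ultimately show ?thesis using C_rel[OF u(2)] by (metis coarse_rel_trans)
  qed (rule C_rel)
  define D where "D = cball y r'"
  have bD: "bounded D" unfolding D_def by simp
  define \<V> where "\<V> = {V \<in> unbounded_components \<mu> D. V \<subseteq> U}"
  define \<Z> where "\<Z> = unbounded_components \<mu> D - \<V>"
  have fin: "finite (unbounded_components \<mu> D)" using finite_unbounded_components[OF bD] .
  then have fin': "finite \<V>" "finite \<Z>" unfolding \<V>_def \<Z>_def by simp_all
  \<comment> \<open>Components that leave \<open>U\<close> all contain \<open>x0\<close>.\<close>
  have "V = W" if V: "V \<in> \<Z>" "W \<in> \<Z>" for V W
  proof -
    have VW: "V \<in> unbounded_components \<mu> D" "W \<in> unbounded_components \<mu> D"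
      using V unfolding \<Z>_def by simp_all
    obtain v where v: "v \<in> V" "v \<notin> U" using V(1) unfolding \<Z>_def \<V>_def by auto
    obtain w where w: "w \<in> W" "w \<notin> U" using V(2) unfolding \<Z>_def \<V>_def by auto
    have "x0 \<in> V" "x0 \<in> W"
      using component_rel[OF VW(1) v(1)] component_rel[OF VW(2) w(1)] outside_rel v(2) w(2)
      unfolding D_def by simp_all
    then show ?thesis by (rule component_inter[OF VW])
  qed
  then have "card \<Z> \<le> Suc 0" unfolding card_le_Suc0_iff_eq[OF fin'(2)] by simp
  obtain g where g: "inj_on g (unbounded_components \<mu> (cball x0 r))"
      "g ` unbounded_components \<mu> (cball x0 r) \<subseteq> unbounded_components \<mu> D"
    using r'(2)[rule_format, of y] unfolding D_def by (elim exE conjE)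
  have "3 \<le> card (unbounded_components \<mu> D)"
    using card_inj_on_le[OF g fin] r(2) by linarith
  also have "unbounded_components \<mu> D = \<V> \<union> \<Z>" unfolding \<Z>_def \<V>_def by auto
  also have "card (\<V> \<union> \<Z>) \<le> card \<V> + card \<Z>" by (rule card_Un_le)
  finally have "\<not> card \<V> \<le> Suc 0" using \<open>card \<Z> \<le> Suc 0\<close> by linarith
  then obtain V1 V2 where V: "V1 \<in> \<V>" "V2 \<in> \<V>" "V1 \<noteq> V2"
    unfolding card_le_Suc0_iff_eq[OF fin'(1)] by auto
  \<comment> \<open>The value at \<open>C \<union> D\<close> lies in both \<open>e' C\<close> and
    \<open>V \<subseteq> U\<close>, which forces \<open>e' C = U = e C\<close>. Of the threads
    obtained from \<open>V1\<close> and \<open>V2\<close>, at most one can be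
    \<open>e\<close>.\<close>
  have *: "\<exists>e'\<in>coarse_threads \<mu>. e' D = V \<and> e' B = e B" if V: "V \<in> \<V>" for V
  proof -
    have V': "V \<in> unbounded_components \<mu> D" "V \<subseteq> U" using V unfolding \<V>_def by auto
    obtain e' where e': "e' \<in> coarse_threads \<mu>" "e' D = V" using thread_through[OF V'(1) bD] .
    have "bounded (C \<union> D)" using bC bD by simp
    obtain u where u: "u \<in> e' (C \<union> D)"
      using unbounded_componentD(2)[OF coarse_threadsD[OF e'(1) \<open>bounded (C \<union> D)\<close>]] by blast
    have "u \<in> e' C" "u \<in> e' D"
      using u coarse_threads_mono[OF e'(1) \<open>bounded (C \<union> D)\<close>, of C]
        coarse_threads_mono[OF e'(1) \<open>bounded (C \<union> D)\<close>, of D] by blast+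
    then have "u \<in> U" using e'(2) V'(2) by auto
    have "e' C = U"
      by (rule component_inter[OF coarse_threadsD[OF e'(1) bC] U \<open>u \<in> e' C\<close> \<open>u \<in> U\<close>])
    then have "e' B = e B"
      unfolding U_def by (rule coarse_threads_eq_mono[OF e'(1) e bC n[folded C_def]])
    then show ?thesis using e' by (intro bexI[of _ e'] conjI)
  qed
  obtain e1 where e1: "e1 \<in> coarse_threads \<mu>" "e1 D = V1" "e1 B = e B"
    using *[OF V(1)] by (elim bexE conjE)
  obtain e2 where e2: "e2 \<in> coarse_threads \<mu>" "e2 D = V2" "e2 B = e B"
    using *[OF V(2)] by (elim bexE conjE)
  show ?thesis
  proof (cases "e1 = e")
    case True
    then have "e2 \<noteq> e" using e1(2) e2(2) V(3) by auto
    then show ?thesis using that[OF e2(1) _ e2(3)] by simp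
  qed (use that[OF e1(1) _ e1(3)] in simp)
qed

lemma cantor_space_coarse_ends_at:
  fixes e1 e2 e3 :: "'a set \<Rightarrow> 'a set"
  assumes e: "e1 \<in> coarse_threads \<mu>" "e2 \<in> coarse_threads \<mu>" "e3 \<in> coarse_threads \<mu>"
    and ne: "e1 \<noteq> e2" "e1 \<noteq> e3" "e2 \<noteq> e3"
  shows "cantor_space (coarse_ends_at \<mu> :: ('a set \<Rightarrow> 'a set) topology)"
proof -
  fix x0 :: 'a
  obtain r where r: "0 \<le> r" "card (unbounded_components \<mu> (cball x0 r)) \<ge> 3"
    using three_components[OF e ne] .
  define q where "q = (\<lambda>(n, U :: 'a set). {e \<in> coarse_threads \<mu>. e (cball x0 (real n)) \<in> {U}})"
  \<comment> \<open>Balls of integer radius around one point suffice because they are cofinal, and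
    finiteness of the components makes the family countable. Inserting the empty set makes it
    visibly nonempty, as enumerating it by \<open>from_nat_into\<close> requires.\<close>
  define \<Q> where "\<Q> = insert {} (q ` (SIGMA n : UNIV. unbounded_components \<mu> (cball x0 (real n))))"
  have "countable (SIGMA n : (UNIV :: nat set). unbounded_components \<mu> (cball x0 (real n)))"
    by (rule countable_SIGMA) (auto intro: countable_finite finite_unbounded_components)
  then have \<Q>: "countable \<Q>" "\<Q> \<noteq> {}" unfolding \<Q>_def by simp_all
  define Q where "Q = from_nat_into \<Q>"
  have rangeQ: "range Q = \<Q>" unfolding Q_def using \<Q> by (intro range_from_nat_into)
  have clopen: "openin (coarse_ends_at \<mu>) S \<and> closedin (coarse_ends_at \<mu>) S" if "S \<in> \<Q>" for S
  proof (cases "S = {}")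
    case False
    then obtain n U where "S = q (n, U)" using \<open>S \<in> \<Q>\<close> unfolding \<Q>_def by auto
    then show ?thesis unfolding q_def by (simp only: prod.case clopen_thread_eval bounded_cball simp_thms)
  qed simp
  show ?thesis
  proof (rule cantor_spaceI[of _ Q])
    show "compact_space (coarse_ends_at \<mu> :: ('a set \<Rightarrow> 'a set) topology)"
      by (rule compact_space_coarse_ends_at[OF finite_unbounded_components])
    show "topspace (coarse_ends_at \<mu> :: ('a set \<Rightarrow> 'a set) topology) \<noteq> {}" using e(1) by auto
    show "openin (coarse_ends_at \<mu>) (Q n)" "closedin (coarse_ends_at \<mu>) (Q n)" for n
      using clopen[of "Q n"] rangeQ by auto
  next
    fix e e' :: "'a set \<Rightarrow> 'a set"
    assume "e \<in> topspace (coarse_ends_at \<mu>)" "e' \<in> topspace (coarse_ends_at \<mu>)" "e \<noteq> e'"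
    then have ee: "e \<in> coarse_threads \<mu>" "e' \<in> coarse_threads \<mu>" "e \<noteq> e'" by simp_all
    then obtain B where B: "bounded B" "e B \<noteq> e' B" using coarse_threads_eqI by metis
    obtain n :: nat where n: "B \<subseteq> cball x0 (real n)" using bounded_in_cball[OF B(1)] by blast
    define U where "U = e (cball x0 (real n))"
    have "e' (cball x0 (real n)) \<noteq> U"
      unfolding U_def using coarse_threads_eq_mono[OF ee(1,2) bounded_cball n] B(2) by metis
    then have "e \<in> q (n, U)" "e' \<notin> q (n, U)" using ee(1) unfolding q_def U_def by auto
    moreover have "q (n, U) \<in> \<Q>"
      unfolding \<Q>_def U_def using coarse_threadsD[OF ee(1) bounded_cball] by blast
    then obtain m where "Q m = q (n, U)" using rangeQ by (metis rangeE)
    ultimately show "\<exists>n. e \<in> Q n \<longleftrightarrow> e' \<notin> Q n" by metis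
  next
    fix e :: "'a set \<Rightarrow> 'a set" assume "e \<in> topspace (coarse_ends_at \<mu>)"
    then have e: "e \<in> coarse_threads \<mu>" by simp
    show "\<not> openin (coarse_ends_at \<mu>) {e}"
    proof
      assume "openin (coarse_ends_at \<mu>) {e}"
      then obtain C where C: "bounded C" "\<And>e'. e' \<in> coarse_threads \<mu> \<Longrightarrow> e' C = e C \<Longrightarrow> e' \<in> {e}"
        using coarse_ends_at_nhd[of \<mu> "{e}" e] by blast
      obtain e' where "e' \<in> coarse_threads \<mu>" "e' \<noteq> e" "e' C = e C"
        using other_end[OF r e C(1)] .
      then show False using C(2) by blast
    qed
  qed
qed

end


section \<open>From the three hypotheses to the locale assumptions, and the final case
  distinction\<close>

lemma chain_of_quasi_convex:
  fixes p :: "nat \<Rightarrow> 'a::metric_space"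
  assumes "p 0 = x" "p n = y" "\<forall>k\<in>{1..n}. dist (p (k - 1)) (p k) \<le> c"
    and len: "(\<Sum>k=1..n. dist (p (k - 1)) (p k)) \<le> t" and "c \<le> \<mu>"
  shows "(x, y) \<in> coarse_rel \<mu> (cball x t)"
proof (rule coarse_relI[OF assms(1,2)])
  fix k assume "k \<le> n"
  \<comment> \<open>Distance from the start is bounded by the length travelled so far, so bounded
    total length confines the whole chain to a ball.\<close>
  have "dist (p 0) (p m) \<le> (\<Sum>k=1..m. dist (p (k - 1)) (p k))" for m
  proof (induction m)
    case (Suc m)
    then show ?case using dist_triangle[of "p 0" "p (Suc m)" "p m"] by simp
  qed simp
  then have "dist (p 0) (p k) \<le> (\<Sum>k=1..k. dist (p (k - 1)) (p k))" .
  also have "\<dots> \<le> (\<Sum>k=1..n. dist (p (k - 1)) (p k))"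
    using \<open>k \<le> n\<close> by (intro sum_mono2) auto
  finally show "p k \<in> cball x t" using len assms(1) by simp
next
  fix k assume "k \<in> {1..n}"
  then show "dist (p (k - 1)) (p k) \<le> \<mu>" using assms(3,5) by force
qed

theorem theorem6p39:
  assumes "coarse_bounded_geometry TYPE('a::metric_space)"
    and "coarsely_quasi_convex TYPE('a)"
    and "coarsely_quasi_symmetric TYPE('a)"
  shows "(finite (topspace (coarse_ends :: (real \<times> ('a set \<Rightarrow> 'a set)) set topology)) \<and>
          card (topspace (coarse_ends :: (real \<times> ('a set \<Rightarrow> 'a set)) set topology)) \<le> 2)
       \<or> cantor_space (coarse_ends :: (real \<times> ('a set \<Rightarrow> 'a set)) set topology)"
proof -
  obtain \<Gamma> :: "'a set" and R Q where \<Gamma>: "R \<ge> 0" "\<forall>x. \<exists>y\<in>\<Gamma>. dist x y \<le> R"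
    "\<forall>x. \<forall>r\<ge>0. finite (cball x r \<inter> \<Gamma>) \<and> real (card (cball x r \<inter> \<Gamma>)) \<le> Q r"
    using assms(1) unfolding coarse_bounded_geometry_def by blast
  obtain a b c :: real where abc: "a \<ge> 0" "b \<ge> 0" "c \<ge> 0"
    "\<forall>x y :: 'a. \<exists>(n :: nat) p. p 0 = x \<and> p n = y \<and> (\<forall>k\<in>{1..n}. dist (p (k - 1)) (p k) \<le> c) \<and>
          (\<Sum>k=1..n. dist (p (k - 1)) (p k)) \<le> a * dist x y + b"
    using assms(2) unfolding coarsely_quasi_convex_def by blast
  obtain K L :: real where KL: "K \<ge> 0" "L \<ge> 1"
    "\<forall>x y :: 'a. \<exists>(A :: 'a set) (A' :: 'a set) (f :: 'a \<Rightarrow> 'a).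
          x \<in> A \<and> y \<in> A' \<and> metric_net K A \<and> metric_net K A' \<and>
          bij_betw f A A' \<and> f x = y \<and>
          (\<forall>u\<in>A. \<forall>v\<in>A. 1 / L * dist u v \<le> dist (f u) (f v) \<and> dist (f u) (f v) \<le> L * dist u v)"
    using assms(3) unfolding coarsely_quasi_symmetric_def by blast
  \<comment> \<open>At this scale the jumps of quasi-convex chains and the passages to both kinds of
    nets are admissible; the 1 ensures positivity.\<close>
  define \<mu> where "\<mu> = max 1 (max c (max R K))"
  have \<mu>: "0 < \<mu>" "c \<le> \<mu>" "R \<le> \<mu>" "K \<le> \<mu>" unfolding \<mu>_def by auto
  interpret coarse_symmetric_geometry \<Gamma> R a b \<mu> K L
  proof unfold_locales
    show "\<exists>y\<in>\<Gamma>. dist x y \<le> R" for x using \<Gamma>(2) by blast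
    show "finite (cball x r \<inter> \<Gamma>)" if "0 \<le> r" for x r using \<Gamma>(3) that by blast
    fix x y :: 'a
    show "\<exists>(A :: 'a set) (A' :: 'a set) f. x \<in> A \<and> y \<in> A' \<and> metric_net K A \<and> metric_net K A' \<and>
          bij_betw f A A' \<and> f x = y \<and>
          (\<forall>u\<in>A. \<forall>v\<in>A. 1 / L * dist u v \<le> dist (f u) (f v) \<and> dist (f u) (f v) \<le> L * dist u v)"
      by (rule KL(3)[rule_format])
    obtain n :: nat and p where "p 0 = x" "p n = y" "\<forall>k\<in>{1..n}. dist (p (k - 1)) (p k) \<le> c"
      "(\<Sum>k=1..n. dist (p (k - 1)) (p k)) \<le> a * dist x y + b"
      using abc(4) by blast
    then show "(x, y) \<in> coarse_rel \<mu> (cball x (a * dist x y + b))"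
      using \<mu>(2) by (rule chain_of_quasi_convex[of p x n y c])
  qed (fact \<Gamma>(1) abc(1,2) KL(1,2) \<mu>(1,3,4))+
  define E where "E = (coarse_threads \<mu> :: ('a set \<Rightarrow> 'a set) set)"
  obtain h where h: "homeomorphic_map (coarse_ends :: (real \<times> ('a set \<Rightarrow> 'a set)) set topology)
      (coarse_ends_at \<mu> :: ('a set \<Rightarrow> 'a set) topology) h"
    using coarse_ends_homeomorphic unfolding homeomorphic_space by blast
  have bij: "bij_betw h (topspace (coarse_ends :: (real \<times> ('a set \<Rightarrow> 'a set)) set topology)) E"
    using homeomorphic_imp_injective_map[OF h] homeomorphic_imp_surjective_map[OF h]
    unfolding bij_betw_def E_def by simp
  show ?thesis
  \<comment> \<open>Since \<open>card\<close> is 0 on infinite sets, finiteness is part of the case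
    condition, and the negative case yields three threads from an infinite \<open>E\<close>
    separately.\<close>
  proof (cases "finite E \<and> card E \<le> 2")
    case True
    then show ?thesis using bij_betw_finite[OF bij] bij_betw_same_card[OF bij] by simp
  next
    case False
    have "\<exists>T\<subseteq>E. card T = 3"
    proof (cases "finite E")
      case True
      then have "3 \<le> card E" using False by simp
      then show ?thesis by (rule obtain_subset_with_card_n) (intro exI conjI)
    next
      case False
      from infinite_arbitrarily_large[OF this, of 3] show ?thesis by (elim exE conjE) (intro exI conjI)
    qed
    then obtain T where T: "T \<subseteq> E" "card T = 3" by (elim exE conjE)
    from T(2) obtain e1 e2 e3 where "T = {e1, e2, e3}" "e1 \<noteq> e2" "e1 \<noteq> e3" "e2 \<noteq> e3"
      unfolding card_3_iff by (elim exE conjE)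
    with T(1) have "{e1, e2, e3} \<subseteq> E" "e1 \<noteq> e2" "e1 \<noteq> e3" "e2 \<noteq> e3" by simp_all
    then have "(coarse_ends_at \<mu> :: ('a set \<Rightarrow> 'a set) topology) homeomorphic_space top_of_set cantor_set"
      unfolding E_def cantor_space_def[symmetric] by (intro cantor_space_coarse_ends_at[of e1 e2 e3]) auto
    from homeomorphic_space_trans[OF coarse_ends_homeomorphic this] show ?thesis
      unfolding cantor_space_def by (rule disjI2)
  qed
qed

end
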